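(* Let $f$ and $g$ each be a (strictly) convex or concave function, and let $A, B \subseteq \mathbb{R}$ be finite sets. Then $$|A|^{49}|B|^{49}\lesssim |A+B|^{38}\, |f(A)+g(B)|^{38}$$ and $$|A|^{39}|B|^{39}\lesssim |A\pm B|^{20}\,|f(A)\pm g(B)|^{20}\,|A-A|^5\,|B-B|^5\,|f(A)-f(A)|^5\,|g(B)-g(B)|^5,$$ where each $\pm$ may be taken as either $+$ or $-$.
   Context: For finite $X,Y\subseteq\mathbb{R}$, $X\pm Y=\{x\pm y: x\in X,y\in Y\}$; $f(A)=\{f(a):a\in A\}$. $f$ and $g$ may independently be convex or concave (e.g. $f$ convex, $g$ concave). $X\lesssim Y$ means $X\le C\,Y(\log(|A||B|))^{C'}$ for absolute constants $C,C'$ (logarithmic factors suppressed). *)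

theory Defs
  imports "HOL-Analysis.Analysis"
begin

definition strictly_convex_on :: "real set \<Rightarrow> (real \<Rightarrow> real) \<Rightarrow> bool"
  where "strictly_convex_on S f \<longleftrightarrow> convex S \<and>
    (\<forall>x\<in>S. \<forall>y\<in>S. \<forall>u>0. \<forall>v>0. x \<noteq> y \<longrightarrow> u + v = 1 \<longrightarrow>
      f (u * x + v * y) < u * f x + v * f y)"

definition strictly_concave_on :: "real set \<Rightarrow> (real \<Rightarrow> real) \<Rightarrow> bool"
  where "strictly_concave_on S f \<longleftrightarrow> strictly_convex_on S (\<lambda>x. - f x)"

(* Named operations, because minus on type set is set difference. *)

definition sumset :: "real set \<Rightarrow> real set \<Rightarrow> real set"
  where "sumset X Y = {x + y | x y. x \<in> X \<and> y \<in> Y}"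

definition diffset :: "real set \<Rightarrow> real set \<Rightarrow> real set"
  where "diffset X Y = {x - y | x y. x \<in> X \<and> y \<in> Y}"

end

theory Submission
  imports Defs
begin

text \<open>
  After passing to half of \<open>A\<close> the function \<open>f\<close> is strictly monotone, and its graph is a Sidon set
  in the plane. Cutting a grid into cells and counting pairs of grid points in a common cell gives
  a Szemeredi--Trotter bound for the translates of such a graph: if every \<open>f a\<close> has at least \<open>T\<close>
  representations as a difference of elements of \<open>R\<close> and \<open>Q\<close>, then the number of \<open>x\<close> with at least
  \<open>t\<close> representations in \<open>C - A\<close> is at most a constant times
  \<open>|Q|\<^sup>2 |R|\<^sup>2 |C|\<^sup>2 / (t T)\<^sup>3\<close>. Write \<open>E A\<close> for the third energy
  \<open>\<Sum>x. r(x)\<^sup>3\<close> of the differences of \<open>A\<close>. Choosing \<open>R = A\<close> and for \<open>Q\<close> the level set of \<open>r\<close>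
  that carries \<open>E A\<close>, on a regularised subset of \<open>A\<close>, the constant for \<open>f A\<close> is about
  \<open>|A|\<^sup>5 / E A\<close>, and symmetrically for \<open>A\<close> and \<open>E (f A)\<close>; in particular
  \<open>E A * E (f A)\<close> is at most about \<open>|A|\<^sup>7\<close>. Conversely, the solutions of
  \<open>a - a' = (a + b) - (a' + b)\<close> with \<open>a + b\<close> and \<open>a' + b\<close> popular sums, together with the
  Cauchy--Schwarz and Hoelder inequalities, bound \<open>|A + B|\<close> and \<open>|A - A|\<close> from below in terms of the
  third energies and these constants. Multiplying the bounds for \<open>(A, B)\<close> and \<open>(f A, g B)\<close>
  eliminates the energies.
\<close>

section \<open>Shift counts, energies and Hoelder inequalities\<close>

text \<open>The obstacle is that the available information sits on opposite coordinates.
  Representations in terms of \<open>f A\<close> control the richness of \<open>A\<close>, so a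
  large third energy of one coordinate makes the constant of the other one small; yet the lower
  bound for \<open>A + B\<close> involves energies and constants of the same coordinate. Only the
  product over both coordinates closes, which is why \<open>A + B\<close> and
  \<open>f A + g B\<close> enter symmetrically. Moreover the incidence bound needs every single
  element to have many representations, not an average one; this is what the regularised subset
  provides. The exponents are bookkeeping. With m = |A||B|, multiplying the two sumset bounds puts
  m^114 on the left, and energies to the power 8 and constants to the power 3 on the right. Pairing
  the constants crosswise with three of the eight energies costs m^10 each time, and the five
  remaining energy products cost m^7 each: 114 - 30 - 35 = 49. For difference sets the count is 90 -
  30 - 21 = 39.\<close>

definition shift_count :: "real set \<Rightarrow> real set \<Rightarrow> real \<Rightarrow> nat"
  where "shift_count U C x = card {u \<in> U. u + x \<in> C}"

definition energy :: "nat \<Rightarrow> real set \<Rightarrow> real"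
  where "energy k U = (\<Sum>x \<in> diffset U U. real (shift_count U U x) ^ k)"

text \<open>The bound \<open>\<sigma>\<close> plays the role of the quantity \<open>d(U) |U|\<close> of the literature, with \<open>d(U)\<close> the
  Szemeredi--Trotter constant of \<open>U\<close>.\<close>

definition rich_bound :: "real set \<Rightarrow> real \<Rightarrow> bool"
  where "rich_bound U \<sigma> \<longleftrightarrow> (\<forall>C t. finite C \<longrightarrow> 0 < t \<longrightarrow>
    real (card {x. t \<le> real (shift_count U C x)}) * t ^ 3 \<le> \<sigma> * real (card C) ^ 2)"

lemma rich_boundD:
  "rich_bound U \<sigma> \<Longrightarrow> finite C \<Longrightarrow> 0 < t \<Longrightarrow>
    real (card {x. t \<le> real (shift_count U C x)}) * t ^ 3 \<le> \<sigma> * real (card C) ^ 2"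
  unfolding rich_bound_def by blast

lemma rich_bound_nonneg:
  assumes "rich_bound U \<sigma>" 
  shows "0 \<le> \<sigma>"
proof -
  have "0 \<le> real (card {x. 1 \<le> real (shift_count U {0} x)}) * 1 ^ 3" by simp
  also have "\<dots> \<le> \<sigma> * real (card {0::real}) ^ 2"
    by (rule rich_boundD[OF assms]) auto
  finally show ?thesis by simp
qed

lemma diffset_eq_image: "diffset X Y = (\<lambda>(x, y). x - y) ` (X \<times> Y)"
  unfolding diffset_def by auto

lemma sumset_eq_image: "sumset X Y = (\<lambda>(x, y). x + y) ` (X \<times> Y)"
  unfolding sumset_def by auto

lemma finite_diffset: "finite X \<Longrightarrow> finite Y \<Longrightarrow> finite (diffset X Y)"
  by (simp add: diffset_eq_image)

lemma finite_sumset: "finite X \<Longrightarrow> finite Y \<Longrightarrow> finite (sumset X Y)"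
  by (simp add: sumset_eq_image)

lemma sumset_commute: "sumset X Y = sumset Y X"
  unfolding sumset_def by (metis (no_types, opaque_lifting) add.commute)

lemma diffset_mono: "X \<subseteq> X' \<Longrightarrow> Y \<subseteq> Y' \<Longrightarrow> diffset X Y \<subseteq> diffset X' Y'"
  unfolding diffset_def by blast

lemma sumset_mono: "X \<subseteq> X' \<Longrightarrow> Y \<subseteq> Y' \<Longrightarrow> sumset X Y \<subseteq> sumset X' Y'"
  unfolding sumset_def by blast

section \<open>Cubic Hoelder inequalities\<close>

text \<open>Hoelder with exponents 3/2 and 3: after scaling both cubic sums to 1 it is the termwise
  inequality 3 u^2 v \<le> 2 u^3 + v^3. Stated with cubes so that no roots occur later.\<close>

lemma sum_square_mult_power3_le:
  fixes x y :: "'a \<Rightarrow> real"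
  assumes "\<And>i. i \<in> I \<Longrightarrow> 0 \<le> x i" "\<And>i. i \<in> I \<Longrightarrow> 0 \<le> y i"
  shows "(\<Sum>i\<in>I. x i ^ 2 * y i) ^ 3 \<le> (\<Sum>i\<in>I. x i ^ 3) ^ 2 * (\<Sum>i\<in>I. y i ^ 3)"
proof (cases "finite I \<and> (\<Sum>i\<in>I. x i ^ 3) > 0 \<and> (\<Sum>i\<in>I. y i ^ 3) > 0")
  case True
  define p where "p = (\<Sum>i\<in>I. x i ^ 3)"
  define q where "q = (\<Sum>i\<in>I. y i ^ 3)"
  define a where "a = root 3 p"
  define b where "b = root 3 q"
  have pq: "p > 0" "q > 0" using True by (auto simp: p_def q_def)
  have a: "a > 0" "a ^ 3 = p" and b: "b > 0" "b ^ 3 = q"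
    using pq by (auto simp: a_def b_def)
  have amgm: "u ^ 2 * v \<le> (2 * u ^ 3 + v ^ 3) / 3" if "u \<ge> 0" "v \<ge> 0" for u v :: real
  proof -
    have "2 * u ^ 3 + v ^ 3 - 3 * (u ^ 2 * v) = (u - v) ^ 2 * (2 * u + v)"
      by (simp add: power2_eq_square power3_eq_cube algebra_simps)
    moreover have "\<dots> \<ge> 0" using that by simp
    ultimately show ?thesis by simp
  qed
  have "(\<Sum>i\<in>I. x i ^ 2 * y i) / (a ^ 2 * b) = (\<Sum>i\<in>I. (x i / a) ^ 2 * (y i / b))"
    by (simp add: sum_divide_distrib power_divide)
  also have "\<dots> \<le> (\<Sum>i\<in>I. (2 * (x i / a) ^ 3 + (y i / b) ^ 3) / 3)"
    by (intro sum_mono amgm) (use assms a b in auto)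
  also have "\<dots> = (2 * (p / a ^ 3) + q / b ^ 3) / 3"
    by (simp add: p_def q_def power_divide sum.distrib flip: sum_divide_distrib sum_distrib_left)
  also have "\<dots> = 1" using a b pq by simp
  finally have "(\<Sum>i\<in>I. x i ^ 2 * y i) \<le> a ^ 2 * b" using a b by (simp add: divide_le_eq)
  hence "(\<Sum>i\<in>I. x i ^ 2 * y i) ^ 3 \<le> (a ^ 2 * b) ^ 3"
    by (intro power_mono sum_nonneg) (use assms in auto)
  also have "\<dots> = (a ^ 3) ^ 2 * b ^ 3" by (simp add: power_mult_distrib flip: power_mult)
  finally show ?thesis using a b by (simp add: p_def q_def)
next
  case False
  have nn: "(\<Sum>i\<in>I. x i ^ 3) \<ge> 0" "(\<Sum>i\<in>I. y i ^ 3) \<ge> 0"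
    by (intro sum_nonneg; use assms in auto)+
  have "(\<Sum>i\<in>I. x i ^ 2 * y i) = 0"
  proof (cases "finite I")
    case fin: True
    then consider "(\<Sum>i\<in>I. x i ^ 3) = 0" | "(\<Sum>i\<in>I. y i ^ 3) = 0" using False nn by linarith
    then show ?thesis
    proof cases
      case 1
      then have "\<forall>i\<in>I. x i ^ 3 = 0"
        using fin assms by (subst (asm) sum_nonneg_eq_0_iff) auto
      then show ?thesis by (intro sum.neutral) auto
    next
      case 2
      then have "\<forall>i\<in>I. y i ^ 3 = 0"
        using fin assms by (subst (asm) sum_nonneg_eq_0_iff) auto
      then show ?thesis by (intro sum.neutral) auto
    qed
  qed simp
  then show ?thesis using nn by simp
qed

text \<open>Cauchy-Schwarz with x split as sqrt x times sqrt x, followed by the previous inequality.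
  The factor x is measured by its first and third moments, the first being known trivially for shift
  counts.\<close>

lemma sum_mult_power6_le:
  fixes x y :: "'a \<Rightarrow> real"
  assumes "\<And>i. i \<in> I \<Longrightarrow> 0 \<le> x i" "\<And>i. i \<in> I \<Longrightarrow> 0 \<le> y i"
  shows "(\<Sum>i\<in>I. x i * y i) ^ 6 \<le> (\<Sum>i\<in>I. x i) ^ 3 * (\<Sum>i\<in>I. x i ^ 3) * (\<Sum>i\<in>I. y i ^ 3) ^ 2"
proof -
  have "(\<Sum>i\<in>I. x i * y i) ^ 2 = (\<Sum>i\<in>I. sqrt (x i) * (sqrt (x i) * y i)) ^ 2"
    using assms by (intro arg_cong[where f = "\<lambda>t. t ^ 2"] sum.cong) (simp_all flip: mult.assoc)
  also have "\<dots> \<le> (\<Sum>i\<in>I. sqrt (x i) ^ 2) * (\<Sum>i\<in>I. (sqrt (x i) * y i) ^ 2)"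
    by (rule Cauchy_Schwarz_ineq_sum)
  also have "\<dots> = (\<Sum>i\<in>I. x i) * (\<Sum>i\<in>I. y i ^ 2 * x i)"
    using assms by (intro arg_cong2[where f = "(*)"] sum.cong) (auto simp: power_mult_distrib mult.commute)
  finally have "((\<Sum>i\<in>I. x i * y i) ^ 2) ^ 3 \<le> ((\<Sum>i\<in>I. x i) * (\<Sum>i\<in>I. y i ^ 2 * x i)) ^ 3"
    by (intro power_mono) auto
  also have "\<dots> = (\<Sum>i\<in>I. x i) ^ 3 * (\<Sum>i\<in>I. y i ^ 2 * x i) ^ 3"
    by (simp add: power_mult_distrib)
  also have "\<dots> \<le> (\<Sum>i\<in>I. x i) ^ 3 * ((\<Sum>i\<in>I. y i ^ 3) ^ 2 * (\<Sum>i\<in>I. x i ^ 3))"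
    by (intro mult_left_mono sum_square_mult_power3_le zero_le_power sum_nonneg) (use assms in auto)
  finally show ?thesis by (simp add: mult_ac flip: power_mult)
qed

section \<open>Dyadic pigeonholing\<close>

lemma sum_atMost_pigeonhole:
  fixes a :: "nat \<Rightarrow> real"
  assumes "E \<le> (\<Sum>k\<le>L. a k)"
  obtains k where "k \<le> L" "E \<le> real (L + 1) * a k"
proof -
  have "\<exists>k\<le>L. E \<le> real (L + 1) * a k"
  proof (rule ccontr)
    assume "\<not> ?thesis"
    then have "real (L + 1) * a k < E" if "k \<le> L" for k using that by (meson not_le)
    then have "a k < E / real (L + 1)" if "k \<le> L" for k
      using that by (simp add: pos_less_divide_eq mult.commute)
    then have "(\<Sum>k\<le>L. a k) < (\<Sum>k\<le>L. E / real (L + 1))"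
      by (intro sum_strict_mono) auto
    then show False using assms by simp
  qed
  then show thesis using that by blast
qed

lemma dyadic_level:
  fixes n L :: nat
  assumes "0 < n" "n \<le> 2 ^ L"
  obtains k where "k \<le> L" "2 ^ k \<le> n" "n < 2 ^ (k + 1)"
proof -
  obtain k where k: "2 ^ k \<le> n" "n < 2 ^ (k + 1)"
    using ex_power_ivl1[of 2 n] assms by auto
  with assms have "(2::nat) ^ k \<le> 2 ^ L" by linarith
  then have "k \<le> L" by simp
  with k that show thesis by blast
qed

text \<open>Every nonzero value lies in exactly one dyadic class; \<open>2 ^ p\<close> pays for
  replacing it by the upper end of the class, and \<open>0 < p\<close> makes zero values contribute
  nothing.\<close>

lemma sum_power_le_dyadic:
  fixes r :: "'a \<Rightarrow> nat"
  assumes "finite X" "\<And>x. x \<in> X \<Longrightarrow> r x \<le> 2 ^ L" "0 < p"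
  shows "(\<Sum>x\<in>X. real (r x) ^ p) \<le>
    (\<Sum>k\<le>L. 2 ^ p * (2 ^ k) ^ p * real (card {x \<in> X. 2 ^ k \<le> r x \<and> r x < 2 ^ (k + 1)}))"
proof -
  have pt: "real (r x) ^ p \<le> (\<Sum>k\<le>L. if 2 ^ k \<le> r x \<and> r x < 2 ^ (k + 1) then 2 ^ p * (2 ^ k) ^ p else 0)"
    if x: "x \<in> X" for x
  proof (cases "r x = 0")
    case True
    then show ?thesis using assms(3) by (simp add: sum_nonneg zero_power)
  next
    case False
    then obtain k where k: "k \<le> L" "2 ^ k \<le> r x" "r x < 2 ^ (k + 1)"
      using dyadic_level[of "r x" L] assms(2)[OF x] by auto
    have "real (r x) \<le> real (2 ^ (k + 1))" using k(3) by (intro of_nat_mono) simp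
    then have "real (r x) ^ p \<le> (2 * 2 ^ k) ^ p" by (intro power_mono) auto
    also have "\<dots> = (if 2 ^ k \<le> r x \<and> r x < 2 ^ (k + 1) then 2 ^ p * (2 ^ k) ^ p else 0)"
      using k by (simp add: power_mult_distrib)
    also have "\<dots> \<le> (\<Sum>k\<le>L. if 2 ^ k \<le> r x \<and> r x < 2 ^ (k + 1) then 2 ^ p * (2 ^ k) ^ p else 0)"
      using k(1) by (intro member_le_sum) auto
    finally show ?thesis .
  qed
  have "(\<Sum>x\<in>X. real (r x) ^ p) \<le>
    (\<Sum>x\<in>X. \<Sum>k\<le>L. if 2 ^ k \<le> r x \<and> r x < 2 ^ (k + 1) then 2 ^ p * (2 ^ k) ^ p else 0)"
    by (intro sum_mono pt)
  also have "\<dots> = (\<Sum>k\<le>L. \<Sum>x\<in>X. if 2 ^ k \<le> r x \<and> r x < 2 ^ (k + 1) then 2 ^ p * (2 ^ k) ^ p else 0)"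
    by (rule sum.swap)
  also have "\<dots> = (\<Sum>k\<le>L. 2 ^ p * (2 ^ k) ^ p * real (card {x \<in> X. 2 ^ k \<le> r x \<and> r x < 2 ^ (k + 1)}))"
    using assms(1) by (intro sum.cong refl) (simp add: sum.If_cases Int_def conj_commute)
  finally show ?thesis .
qed

section \<open>Moments of shift counts\<close>

lemma shift_count_le: "finite U \<Longrightarrow> shift_count U C x \<le> card U"
  unfolding shift_count_def by (intro card_mono) auto

lemma shift_count_mono:
  "finite U' \<Longrightarrow> U \<subseteq> U' \<Longrightarrow> C \<subseteq> C' \<Longrightarrow> shift_count U C x \<le> shift_count U' C' x"
  unfolding shift_count_def by (intro card_mono) auto

lemma shift_count_pos_imp: "0 < shift_count U C x \<Longrightarrow> x \<in> diffset C U"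
proof -
  assume "0 < shift_count U C x"
  then have "{u \<in> U. u + x \<in> C} \<noteq> {}" by (auto simp: shift_count_def card_gt_0_iff)
  then obtain u where "u \<in> U" "u + x \<in> C" by auto
  moreover have "x = (u + x) - u" by simp
  ultimately show ?thesis unfolding diffset_def by blast
qed

text \<open>For positive t a rich shift is a difference of C and U. Finiteness matters since
  \<open>card\<close> of an infinite set is 0, which would defeat every use of
  \<open>card_mono\<close>.\<close>

lemma finite_rich:
  assumes "finite U" "finite C" "0 < t"
  shows "finite {x. t \<le> real (shift_count U C x)}"
proof (rule finite_subset)
  show "{x. t \<le> real (shift_count U C x)} \<subseteq> diffset C U"
    using assms(3) by (auto intro!: shift_count_pos_imp gr0I)
qed (use assms finite_diffset in auto)

lemma sum_shift_count_le:
  assumes "finite U" "finite C" "finite X"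
  shows "(\<Sum>x\<in>X. real (shift_count U C x)) \<le> real (card U) * real (card C)"
proof -
  have "(\<Sum>x\<in>X. shift_count U C x) = card (SIGMA x:X. {u \<in> U. u + x \<in> C})"
    using assms by (simp add: shift_count_def)
  also have "\<dots> \<le> card (U \<times> C)"
    by (rule card_inj_on_le[where f = "\<lambda>(x, u). (u, u + x)"])
      (use assms in \<open>auto simp: inj_on_def\<close>)
  finally have "real (\<Sum>x\<in>X. shift_count U C x) \<le> real (card (U \<times> C))"
    by (simp only: of_nat_le_iff)
  then show ?thesis by (simp add: card_cartesian_product)
qed

lemma sum_le_energy:
  assumes "finite U" "finite X" "0 < k"
  shows "(\<Sum>x\<in>X. real (shift_count U U x) ^ k) \<le> energy k U"
proof -
  have "(\<Sum>x\<in>X. real (shift_count U U x) ^ k) = (\<Sum>x\<in>X \<inter> diffset U U. real (shift_count U U x) ^ k)"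
    using assms shift_count_pos_imp by (intro sum.mono_neutral_right) auto
  also have "\<dots> \<le> energy k U"
    unfolding energy_def using assms finite_diffset by (intro sum_mono2) auto
  finally show ?thesis .
qed

lemma energy_mono:
  assumes "finite U'" "U \<subseteq> U'" "0 < k"
  shows "energy k U \<le> energy k U'"
proof -
  have fin: "finite U" using assms finite_subset by blast
  have "energy k U \<le> (\<Sum>x \<in> diffset U U. real (shift_count U' U' x) ^ k)"
    unfolding energy_def using assms by (intro sum_mono power_mono) (auto intro!: shift_count_mono)
  also have "\<dots> \<le> energy k U'"
    using fin assms by (intro sum_le_energy finite_diffset) auto
  finally show ?thesis .
qed

lemma energy_nonneg: "0 \<le> energy k U"
  unfolding energy_def by (intro sum_nonneg) auto

lemma energy_pos:
  assumes "finite U" "U \<noteq> {}"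
  shows "1 \<le> energy k U"
proof -
  obtain u where u: "u \<in> U" using assms by auto
  have "shift_count U U 0 \<ge> 1" using assms by (auto simp: shift_count_def Suc_le_eq card_gt_0_iff)
  then have "1 \<le> real (shift_count U U 0) ^ k" by simp
  also have "\<dots> \<le> energy k U"
    unfolding energy_def
    using u assms finite_diffset[of U U] by (intro member_le_sum) (auto simp: diffset_def)
  finally show ?thesis .
qed

lemma rich_bound_mono:
  assumes "rich_bound U' \<sigma>" "U \<subseteq> U'" "finite U'"
  shows "rich_bound U \<sigma>"
  unfolding rich_bound_def
proof (intro allI impI)
  fix C :: "real set" and t :: real assume C: "finite C" "0 < t"
  have "card {x. t \<le> real (shift_count U C x)} \<le> card {x. t \<le> real (shift_count U' C x)}"
  proof (intro card_mono finite_rich)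
    have "shift_count U C x \<le> shift_count U' C x" for x
      using assms by (intro shift_count_mono) auto
    then show "{x. t \<le> real (shift_count U C x)} \<subseteq> {x. t \<le> real (shift_count U' C x)}"
      by (auto intro: order_trans)
  qed (use assms C in auto)
  then have "real (card {x. t \<le> real (shift_count U C x)}) * t ^ 3
      \<le> real (card {x. t \<le> real (shift_count U' C x)}) * t ^ 3"
    using C by (intro mult_right_mono) auto
  also have "\<dots> \<le> \<sigma> * real (card C) ^ 2"
    using assms(1) C by (intro rich_boundD)
  finally show "real (card {x. t \<le> real (shift_count U C x)}) * t ^ 3 \<le> \<sigma> * real (card C) ^ 2" .
qed

text \<open>The third moment is critical for \<open>rich_bound\<close>: each dyadic level
  contributes at most 8 \<sigma> |C|^2 whatever its height, so summing the L + 1 \<le> 2 L levels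
  costs only a logarithm.\<close>

lemma sum_shift_count_cube_le:
  assumes "rich_bound U \<sigma>" "finite U" "card U \<le> 2 ^ L" "1 \<le> L" "finite C" "finite X"
  shows "(\<Sum>x\<in>X. real (shift_count U C x) ^ 3) \<le> 16 * real L * \<sigma> * real (card C) ^ 2"
proof -
  have lvl: "2 ^ 3 * (2 ^ k) ^ 3 * real (card {x \<in> X. 2 ^ k \<le> shift_count U C x \<and> shift_count U C x < 2 ^ (k + 1)})
     \<le> 8 * (\<sigma> * real (card C) ^ 2)" for k
  proof -
    have "card {x \<in> X. 2 ^ k \<le> shift_count U C x \<and> shift_count U C x < 2 ^ (k + 1)}
      \<le> card {x. 2 ^ k \<le> real (shift_count U C x)}"
    proof (intro card_mono finite_rich subsetI)
      fix x assume "x \<in> {x \<in> X. 2 ^ k \<le> shift_count U C x \<and> shift_count U C x < 2 ^ (k + 1)}"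
      then have "real (2 ^ k) \<le> real (shift_count U C x)" by (intro of_nat_mono) simp
      then show "x \<in> {x. 2 ^ k \<le> real (shift_count U C x)}" by simp
    qed (use assms in auto)
    then have "real (card {x \<in> X. 2 ^ k \<le> shift_count U C x \<and> shift_count U C x < 2 ^ (k + 1)}) * (2 ^ k) ^ 3
      \<le> real (card {x. 2 ^ k \<le> real (shift_count U C x)}) * (2 ^ k) ^ 3"
      by (intro mult_right_mono) auto
    also have "\<dots> \<le> \<sigma> * real (card C) ^ 2"
      by (rule rich_boundD) (use assms in auto)
    finally show ?thesis by (simp add: mult_ac)
  qed
  have nn: "0 \<le> \<sigma> * real (card C) ^ 2"
    using rich_bound_nonneg[OF assms(1)] by simp
  have "(\<Sum>x\<in>X. real (shift_count U C x) ^ 3) \<le>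
    (\<Sum>k\<le>L. 2 ^ 3 * (2 ^ k) ^ 3 * real (card {x \<in> X. 2 ^ k \<le> shift_count U C x \<and> shift_count U C x < 2 ^ (k + 1)}))"
    by (intro sum_power_le_dyadic order_trans[OF shift_count_le]) (use assms in auto)
  also have "\<dots> \<le> (\<Sum>k\<le>L. 8 * (\<sigma> * real (card C) ^ 2))" by (intro sum_mono lvl)
  also have "\<dots> = real (L + 1) * (8 * (\<sigma> * real (card C) ^ 2))" by simp
  also have "\<dots> \<le> (2 * real L) * (8 * (\<sigma> * real (card C) ^ 2))"
    using assms nn by (intro mult_right_mono) auto
  finally show ?thesis by (simp add: mult_ac)
qed

lemma energy_le_of_rich_bound:
  assumes "rich_bound U \<sigma>" "finite U" "card U \<le> 2 ^ L" "1 \<le> L"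
  shows "energy 3 U \<le> 16 * real L * \<sigma> * real (card U) ^ 2"
  unfolding energy_def using assms by (intro sum_shift_count_cube_le finite_diffset)

section \<open>Incidences with translates of a Sidon curve\<close>

text \<open>Two coordinate functions on an index set, rather than a function on the first coordinates, so
  that the roles of \<open>A\<close> and \<open>f A\<close> can be exchanged.\<close>

definition curve :: "'i set \<Rightarrow> ('i \<Rightarrow> real) \<Rightarrow> ('i \<Rightarrow> real) \<Rightarrow> bool"
  where "curve I \<alpha> \<beta> \<longleftrightarrow> finite I \<and> inj_on \<alpha> I \<and> inj_on \<beta> I \<and>
    ((\<forall>i\<in>I. \<forall>j\<in>I. \<alpha> i < \<alpha> j \<longleftrightarrow> \<beta> i < \<beta> j) \<or> (\<forall>i\<in>I. \<forall>j\<in>I. \<alpha> i < \<alpha> j \<longleftrightarrow> \<beta> j < \<beta> i)) \<and>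
    (\<forall>i\<in>I. \<forall>j\<in>I. \<forall>k\<in>I. \<forall>l\<in>I.
      \<alpha> i - \<alpha> j = \<alpha> k - \<alpha> l \<longrightarrow> \<beta> i - \<beta> j = \<beta> k - \<beta> l \<longrightarrow> i = j \<or> i = k)"

lemma curve_swap: "curve I \<alpha> \<beta> \<Longrightarrow> curve I \<beta> \<alpha>"
  unfolding curve_def by (elim conjE, intro conjI) blast+

lemma curve_subset: "curve I \<alpha> \<beta> \<Longrightarrow> J \<subseteq> I \<Longrightarrow> curve J \<alpha> \<beta>"
  unfolding curve_def by (meson finite_subset inj_on_subset subsetD)

section \<open>Cell decomposition for monotone curves\<close>

lemma exists_monotone_coloring:
  fixes C :: "real set"
  assumes "finite C" "1 \<le> p" "p \<le> card C"
  obtains \<kappa> :: "real \<Rightarrow> nat" where "\<And>x. x \<in> C \<Longrightarrow> \<kappa> x < p"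
    "\<And>x y. x \<in> C \<Longrightarrow> y \<in> C \<Longrightarrow> x \<le> y \<Longrightarrow> \<kappa> x \<le> \<kappa> y"
    "\<And>j. real (card {x \<in> C. \<kappa> x = j}) \<le> 2 * real (card C) / real p"
proof -
  define n where "n = card C"
  \<comment> \<open>The ceiling of n / p: blocks of s consecutive ranks need at most p colours, and
    \<open>p \<le> n\<close> keeps the rounding below a factor 2.\<close>
  define s where "s = (n + p - 1) div p"
  define rank where "rank = (\<lambda>x. card {y \<in> C. y < x})"
  have np: "1 \<le> p" "p \<le> n" using assms by (auto simp: n_def)
  have "p \<le> n + p - 1" using np by linarith
  then have s1: "1 \<le> s" using np unfolding s_def by (simp add: Suc_le_eq div_greater_zero_iff)
  have sp: "n \<le> p * s"
  proof -
    have "n + p - 1 = p * s + (n + p - 1) mod p" unfolding s_def by simp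
    moreover have "(n + p - 1) mod p < p" using np by simp
    ultimately show ?thesis by linarith
  qed
  have "p * s \<le> n + p - 1" unfolding s_def by simp
  then have "p * s \<le> 2 * n" using np by linarith
  then have "real (p * s) \<le> real (2 * n)" by (rule of_nat_mono)
  then have s2: "real s \<le> 2 * real n / real p" using np by (simp add: field_simps)
  have rank_mono: "rank x < rank y" if "x \<in> C" "y \<in> C" "x < y" for x y
    unfolding rank_def using that assms(1) by (intro psubset_card_mono) auto
  have rank_lt: "rank x < n" if "x \<in> C" for x
    unfolding rank_def n_def using that assms(1) by (intro psubset_card_mono) auto
  have inj: "inj_on rank C"
    by (rule inj_onI) (metis less_irrefl linorder_neqE rank_mono)
  define \<kappa> where "\<kappa> = (\<lambda>x. rank x div s)"
  show thesis
  proof (rule that)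
    fix x assume "x \<in> C"
    then have "rank x < p * s" using rank_lt sp by fastforce
    then show "\<kappa> x < p" unfolding \<kappa>_def by (rule less_mult_imp_div_less)
  next
    fix x y assume "x \<in> C" "y \<in> C" "x \<le> y"
    then have "rank x \<le> rank y" by (metis le_less rank_mono)
    then show "\<kappa> x \<le> \<kappa> y" unfolding \<kappa>_def by (rule div_le_mono)
  next
    fix j
    have "card {x \<in> C. \<kappa> x = j} \<le> card {j * s..<j * s + s}"
    proof (rule card_inj_on_le[where f = rank])
      show "inj_on rank {x \<in> C. \<kappa> x = j}" using inj by (rule inj_on_subset) auto
      show "rank ` {x \<in> C. \<kappa> x = j} \<subseteq> {j * s..<j * s + s}"
      proof
        fix y assume "y \<in> rank ` {x \<in> C. \<kappa> x = j}"
        then have "y div s = j" by (auto simp: \<kappa>_def)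
        then have "y = j * s + y mod s" by auto
        moreover have "y mod s < s" using s1 by simp
        ultimately show "y \<in> {j * s..<j * s + s}" by simp
      qed
    qed auto
    then have "card {x \<in> C. \<kappa> x = j} \<le> s" by simp
    then have "real (card {x \<in> C. \<kappa> x = j}) \<le> real s" by simp
    then show "real (card {x \<in> C. \<kappa> x = j}) \<le> 2 * real (card C) / real p"
      using s2 unfolding n_def by linarith
  qed
qed

lemma card_image_le_card_image:
  assumes "finite M" "\<And>i j. i \<in> M \<Longrightarrow> j \<in> M \<Longrightarrow> h i = h j \<Longrightarrow> c i = c j"
  shows "card (c ` M) \<le> card (h ` M)"
proof -
  have "c i = c (inv_into M h (h i))" if "i \<in> M" for i
    using that by (intro assms(2) inv_into_into) (auto simp: f_inv_into_f)
  then have eq: "c ` M = (c \<circ> inv_into M h) ` (h ` M)" unfolding image_comp by (intro image_cong) auto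
  show ?thesis unfolding eq using assms(1) by (intro card_image_le finite_imageI)
qed

text \<open>Along an increasing chain of cells the sum of the two indices grows strictly from one
  cell to the next, so it identifies the cell and takes fewer than 2 p values.\<close>

lemma staircase_cells_le:
  fixes \<kappa> \<rho> :: "'i \<Rightarrow> nat"
  assumes "finite M" "\<And>i. i \<in> M \<Longrightarrow> \<kappa> i < p" "\<And>i. i \<in> M \<Longrightarrow> \<rho> i < p"
    and mono: "(\<forall>i\<in>M. \<forall>j\<in>M. \<kappa> i \<le> \<kappa> j \<and> \<rho> i \<le> \<rho> j \<or> \<kappa> j \<le> \<kappa> i \<and> \<rho> j \<le> \<rho> i) \<or>
      (\<forall>i\<in>M. \<forall>j\<in>M. \<kappa> i \<le> \<kappa> j \<and> \<rho> j \<le> \<rho> i \<or> \<kappa> j \<le> \<kappa> i \<and> \<rho> i \<le> \<rho> j)"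
  shows "card ((\<lambda>i. (\<kappa> i, \<rho> i)) ` M) \<le> 2 * p"
proof -
  have *: "card ((\<lambda>i. (\<kappa> i, \<rho> i)) ` M) \<le> 2 * p"
    if "\<And>i. i \<in> M \<Longrightarrow> h i < 2 * p"
      "\<And>i j. i \<in> M \<Longrightarrow> j \<in> M \<Longrightarrow> h i = h j \<Longrightarrow> \<kappa> i = \<kappa> j \<and> \<rho> i = \<rho> j" for h :: "'i \<Rightarrow> nat"
  proof -
    have "card ((\<lambda>i. (\<kappa> i, \<rho> i)) ` M) \<le> card (h ` M)"
      by (rule card_image_le_card_image[OF assms(1)]) (drule (2) that(2), simp)
    also have "\<dots> \<le> card {..<2 * p}" using that(1) by (intro card_mono) auto
    finally show ?thesis by simp
  qed
  from mono show ?thesis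
  proof
    assume m: "\<forall>i\<in>M. \<forall>j\<in>M. \<kappa> i \<le> \<kappa> j \<and> \<rho> i \<le> \<rho> j \<or> \<kappa> j \<le> \<kappa> i \<and> \<rho> j \<le> \<rho> i"
    show ?thesis
    proof (rule *[of "\<lambda>i. \<kappa> i + \<rho> i"])
      fix i assume "i \<in> M"
      then show "\<kappa> i + \<rho> i < 2 * p" using assms(2)[of i] assms(3)[of i] by linarith
    next
      fix i j assume "i \<in> M" "j \<in> M" "\<kappa> i + \<rho> i = \<kappa> j + \<rho> j"
      moreover from this m have "\<kappa> i \<le> \<kappa> j \<and> \<rho> i \<le> \<rho> j \<or> \<kappa> j \<le> \<kappa> i \<and> \<rho> j \<le> \<rho> i" by blast
      ultimately show "\<kappa> i = \<kappa> j \<and> \<rho> i = \<rho> j" by linarith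
    qed
  next
    assume m: "\<forall>i\<in>M. \<forall>j\<in>M. \<kappa> i \<le> \<kappa> j \<and> \<rho> j \<le> \<rho> i \<or> \<kappa> j \<le> \<kappa> i \<and> \<rho> i \<le> \<rho> j"
    \<comment> \<open>A decreasing chain becomes increasing after reflecting the second index; since
      \<open>\<rho> i < p\<close> the natural-number subtraction is never truncated.\<close>
    show ?thesis
    proof (rule *[of "\<lambda>i. \<kappa> i + (p - \<rho> i)"])
      fix i assume "i \<in> M"
      then show "\<kappa> i + (p - \<rho> i) < 2 * p" using assms(2)[of i] assms(3)[of i] by linarith
    next
      fix i j assume ij: "i \<in> M" "j \<in> M" "\<kappa> i + (p - \<rho> i) = \<kappa> j + (p - \<rho> j)"
      moreover from this m have "\<kappa> i \<le> \<kappa> j \<and> \<rho> j \<le> \<rho> i \<or> \<kappa> j \<le> \<kappa> i \<and> \<rho> i \<le> \<rho> j" by blast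
      moreover have "\<rho> i < p" "\<rho> j < p" using assms(3) ij by auto
      ultimately show "\<kappa> i = \<kappa> j \<and> \<rho> i = \<rho> j" by linarith
    qed
  qed
qed

text \<open>One representative per cell is paid for by the cells; any other element is charged to
  the pair it forms with its representative.\<close>

lemma card_le_cells_plus_pairs:
  assumes "finite M"
  shows "card M \<le> card (c ` M) + card {(i, j). i \<in> M \<and> j \<in> M \<and> i \<noteq> j \<and> c i = c j}"
proof -
  define r where "r = (\<lambda>i. inv_into M c (c i))"
  have r: "r i \<in> M" "c (r i) = c i" if "i \<in> M" for i
    using that unfolding r_def by (auto simp: inv_into_into f_inv_into_f)
  have "card M = card ({i \<in> M. r i = i} \<union> {i \<in> M. r i \<noteq> i})" by (rule arg_cong[where f = card]) auto
  also have "\<dots> \<le> card {i \<in> M. r i = i} + card {i \<in> M. r i \<noteq> i}" by (rule card_Un_le)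
  also have "card {i \<in> M. r i = i} \<le> card (c ` M)"
  proof (rule card_inj_on_le[where f = c])
    show "inj_on c {i \<in> M. r i = i}"
    proof (rule inj_onI)
      fix i j assume "i \<in> {i \<in> M. r i = i}" "j \<in> {i \<in> M. r i = i}" and cij: "c i = c j"
      then have "i = r i" "r j = j" by auto
      moreover have "r i = r j" using cij by (simp add: r_def)
      ultimately show "i = j" by metis
    qed
  qed (use assms in auto)
  also have "card {i \<in> M. r i \<noteq> i} \<le> card {(i, j). i \<in> M \<and> j \<in> M \<and> i \<noteq> j \<and> c i = c j}"
  proof (rule card_inj_on_le[where f = "\<lambda>i. (i, r i)"])
    show "finite {(i, j). i \<in> M \<and> j \<in> M \<and> i \<noteq> j \<and> c i = c j}"
      by (rule finite_subset[of _ "M \<times> M"]) (use assms in auto)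
    show "(\<lambda>i. (i, r i)) ` {i \<in> M. r i \<noteq> i} \<subseteq> {(i, j). i \<in> M \<and> j \<in> M \<and> i \<noteq> j \<and> c i = c j}"
    proof (rule image_subsetI)
      fix i assume "i \<in> {i \<in> M. r i \<noteq> i}"
      then show "(i, r i) \<in> {(i, j). i \<in> M \<and> j \<in> M \<and> i \<noteq> j \<and> c i = c j}"
        using r[of i] by (simp add: eq_commute[of i])
    qed
  qed (auto simp: inj_on_def)
  finally show ?thesis by simp
qed

text \<open>A monotone curve meets at most \<open>2 p\<close> cells of a \<open>p \<times> p\<close> subdivision of \<open>C \<times> R\<close>, and by
  the Sidon property two points of a cell lie on at most one translate.\<close>

lemma curve_incidences_le:
  fixes \<alpha> \<beta> :: "'i \<Rightarrow> real"
  assumes cv: "curve I \<alpha> \<beta>" and fin: "finite X" "finite Q" "finite C" "finite R"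
    and p: "1 \<le> p" "p \<le> card C" "p \<le> card R"
  shows "(\<Sum>(x, q)\<in>X \<times> Q. real (card {i \<in> I. \<alpha> i + x \<in> C \<and> \<beta> i + q \<in> R}))
    \<le> 2 * real p * real (card X) * real (card Q) + 4 * real (card C) ^ 2 * real (card R) ^ 2 / real p ^ 2"
proof -
  have finI: "finite I" using cv by (simp add: curve_def)
  obtain \<kappa> where \<kappa>: "\<And>x. x \<in> C \<Longrightarrow> \<kappa> x < p" "\<And>x y. x \<in> C \<Longrightarrow> y \<in> C \<Longrightarrow> x \<le> y \<Longrightarrow> \<kappa> x \<le> \<kappa> y"
    "\<And>j. real (card {x \<in> C. \<kappa> x = j}) \<le> 2 * real (card C) / real p"
    using exists_monotone_coloring[OF fin(3) p(1,2)] by metis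
  obtain \<rho> where \<rho>: "\<And>x. x \<in> R \<Longrightarrow> \<rho> x < p" "\<And>x y. x \<in> R \<Longrightarrow> y \<in> R \<Longrightarrow> x \<le> y \<Longrightarrow> \<rho> x \<le> \<rho> y"
    "\<And>j. real (card {x \<in> R. \<rho> x = j}) \<le> 2 * real (card R) / real p"
    using exists_monotone_coloring[OF fin(4) p(1,3)] by metis
  define M where "M = (\<lambda>(x, q). {i \<in> I. \<alpha> i + x \<in> C \<and> \<beta> i + q \<in> R})"
  define c where "c = (\<lambda>(x, q) i. (\<kappa> (\<alpha> i + x), \<rho> (\<beta> i + q)))"
  define N where "N = (\<lambda>w. {(i, j). i \<in> M w \<and> j \<in> M w \<and> i \<noteq> j \<and> c w i = c w j})"
  have finM: "finite (M w)" for w unfolding M_def using finI by (cases w) auto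
  have finN: "finite (N w)" for w
    unfolding N_def by (rule finite_subset[of _ "M w \<times> M w"]) (use finM in auto)
  have mono: "(\<forall>i\<in>I. \<forall>j\<in>I. \<alpha> i < \<alpha> j \<longleftrightarrow> \<beta> i < \<beta> j) \<or> (\<forall>i\<in>I. \<forall>j\<in>I. \<alpha> i < \<alpha> j \<longleftrightarrow> \<beta> j < \<beta> i)"
    using cv by (simp add: curve_def)
  have cells: "card (c w ` M w) \<le> 2 * p" for w
  proof -
    obtain x q where w: "w = (x, q)" by (cases w)
    have "card ((\<lambda>i. (\<kappa> (\<alpha> i + x), \<rho> (\<beta> i + q))) ` M w) \<le> 2 * p"
    proof (rule staircase_cells_le[where \<kappa> = "\<lambda>i. \<kappa> (\<alpha> i + x)" and \<rho> = "\<lambda>i. \<rho> (\<beta> i + q)"])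
      have le\<kappa>: "\<kappa> (\<alpha> i + x) \<le> \<kappa> (\<alpha> j + x)" if "i \<in> M w" "j \<in> M w" "\<alpha> i \<le> \<alpha> j" for i j
        using that by (intro \<kappa>) (auto simp: M_def w)
      have le\<rho>: "\<rho> (\<beta> i + q) \<le> \<rho> (\<beta> j + q)" if "i \<in> M w" "j \<in> M w" "\<beta> i \<le> \<beta> j" for i j
        using that by (intro \<rho>) (auto simp: M_def w)
      have MI: "M w \<subseteq> I" by (auto simp: M_def w)
      show "(\<forall>i\<in>M w. \<forall>j\<in>M w. \<kappa> (\<alpha> i + x) \<le> \<kappa> (\<alpha> j + x) \<and> \<rho> (\<beta> i + q) \<le> \<rho> (\<beta> j + q)
            \<or> \<kappa> (\<alpha> j + x) \<le> \<kappa> (\<alpha> i + x) \<and> \<rho> (\<beta> j + q) \<le> \<rho> (\<beta> i + q)) \<or>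
          (\<forall>i\<in>M w. \<forall>j\<in>M w. \<kappa> (\<alpha> i + x) \<le> \<kappa> (\<alpha> j + x) \<and> \<rho> (\<beta> j + q) \<le> \<rho> (\<beta> i + q)
            \<or> \<kappa> (\<alpha> j + x) \<le> \<kappa> (\<alpha> i + x) \<and> \<rho> (\<beta> i + q) \<le> \<rho> (\<beta> j + q))"
        using mono
      proof (elim disjE)
        assume m: "\<forall>i\<in>I. \<forall>j\<in>I. \<alpha> i < \<alpha> j \<longleftrightarrow> \<beta> i < \<beta> j"
        have "\<beta> i \<le> \<beta> j" if "i \<in> M w" "j \<in> M w" "\<alpha> i \<le> \<alpha> j" for i j
          using m that MI by (meson not_le subsetD)
        then show ?thesis by (intro disjI1[OF ballI] ballI) (meson le\<kappa> le\<rho> linear)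
      next
        assume m: "\<forall>i\<in>I. \<forall>j\<in>I. \<alpha> i < \<alpha> j \<longleftrightarrow> \<beta> j < \<beta> i"
        have "\<beta> j \<le> \<beta> i" if "i \<in> M w" "j \<in> M w" "\<alpha> i \<le> \<alpha> j" for i j
          using m that MI by (meson not_le subsetD)
        then show ?thesis by (intro disjI2[OF ballI] ballI) (meson le\<kappa> le\<rho> linear)
      qed
    qed (use finM \<kappa>(1) \<rho>(1) in \<open>auto simp: M_def w\<close>)
    then show ?thesis by (simp add: c_def w)
  qed
  \<comment> \<open>Pairs of grid points in a common cell: |C||R| choices for the first point and at
    most (2|C|/p)(2|R|/p) for the second.\<close>
  define K where "K = (SIGMA cr:C \<times> R. {c' \<in> C. \<kappa> c' = \<kappa> (fst cr)} \<times> {r' \<in> R. \<rho> r' = \<rho> (snd cr)})"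
  have finK: "finite K" unfolding K_def using fin by auto
  have "card (SIGMA w:X \<times> Q. N w) \<le> card K"
  proof (rule card_inj_on_le[where f = "\<lambda>((x, q), (i, j)). ((\<alpha> i + x, \<beta> i + q), (\<alpha> j + x, \<beta> j + q))"])
    show "inj_on (\<lambda>((x, q), (i, j)). ((\<alpha> i + x, \<beta> i + q), (\<alpha> j + x, \<beta> j + q))) (SIGMA w:X \<times> Q. N w)"
    proof (rule inj_onI, clarsimp simp: N_def M_def)
      fix x q i j x' q' k l
      assume I: "i \<in> I" "j \<in> I" "k \<in> I" "l \<in> I" "i \<noteq> j"
        and e: "\<alpha> i + x = \<alpha> k + x'" "\<beta> i + q = \<beta> k + q'" "\<alpha> j + x = \<alpha> l + x'" "\<beta> j + q = \<beta> l + q'"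
      \<comment> \<open>The Sidon alternative \<open>i = j\<close> is excluded in \<open>N\<close>,
        so the two grid points determine the index i and with it the translate.\<close>
      have "\<alpha> i - \<alpha> j = \<alpha> k - \<alpha> l" "\<beta> i - \<beta> j = \<beta> k - \<beta> l" using e by linarith+
      then have "i = k" using cv I unfolding curve_def by blast
      moreover from this e have "x = x'" "q = q'" by auto
      moreover from this e have "\<alpha> j = \<alpha> l" by auto
      then have "j = l" using cv I unfolding curve_def inj_on_def by blast
      ultimately show "x = x' \<and> q = q' \<and> i = k \<and> j = l" by simp
    qed
  qed (use finK in \<open>auto simp: N_def M_def c_def K_def\<close>)
  then have "(\<Sum>w\<in>X \<times> Q. card (N w)) \<le> card K" using fin finN by (simp add: card_SigmaI)
  then have "real (\<Sum>w\<in>X \<times> Q. card (N w)) \<le> real (card K)" by (rule of_nat_mono)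
  also have "real (card K) = (\<Sum>cr\<in>C \<times> R. real (card {c' \<in> C. \<kappa> c' = \<kappa> (fst cr)}) * real (card {r' \<in> R. \<rho> r' = \<rho> (snd cr)}))"
    unfolding K_def using fin by (simp add: card_SigmaI card_cartesian_product)
  also have "\<dots> \<le> (\<Sum>cr\<in>C \<times> R. (2 * real (card C) / real p) * (2 * real (card R) / real p))"
    by (intro sum_mono mult_mono \<kappa>(3) \<rho>(3)) auto
  also have "\<dots> = 4 * real (card C) ^ 2 * real (card R) ^ 2 / real p ^ 2"
    by (simp add: card_cartesian_product power2_eq_square)
  finally have pairs: "(\<Sum>w\<in>X \<times> Q. real (card (N w))) \<le> 4 * real (card C) ^ 2 * real (card R) ^ 2 / real p ^ 2"
    by simp
  have "(\<Sum>w\<in>X \<times> Q. real (card (M w))) \<le> (\<Sum>w\<in>X \<times> Q. 2 * real p + real (card (N w)))"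
  proof (rule sum_mono)
    fix w
    have "card (M w) \<le> 2 * p + card (N w)"
      using card_le_cells_plus_pairs[OF finM, of w "c w"] cells[of w] unfolding N_def by linarith
    then have "real (card (M w)) \<le> real (2 * p + card (N w))" by (rule of_nat_mono)
    then show "real (card (M w)) \<le> 2 * real p + real (card (N w))" by simp
  qed
  also have "\<dots> = 2 * real p * real (card X) * real (card Q) + (\<Sum>w\<in>X \<times> Q. real (card (N w)))"
    by (simp add: sum.distrib card_cartesian_product)
  finally show ?thesis using pairs by (simp add: M_def case_prod_unfold)
qed

section \<open>A Szemeredi-Trotter bound for translates\<close>

lemma double_count:
  assumes "finite A" "finite B"
  shows "(\<Sum>b\<in>B. card {a \<in> A. P a b}) = (\<Sum>a\<in>A. card {b \<in> B. P a b})"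
  using sum_multicount_gen[of A B P "\<lambda>b. card {a \<in> A. P a b}"] assms by simp

text \<open>A t-rich x has at least t indices i, each of them with T elements q, hence t T
  incidences with the translates by (x, q), q in Q. Comparing |X| t T with
  \<open>curve_incidences_le\<close> and optimising p gives the cubic bound. The representations
  concern \<open>\<beta>\<close> while the conclusion concerns \<open>\<alpha>\<close>; this is how
  the coordinates interact.\<close>

theorem rich_bound_of_curve:
  fixes \<alpha> \<beta> :: "'i \<Rightarrow> real"
  assumes cv: "curve I \<alpha> \<beta>" and fin: "finite Q" "finite R" and T: "0 < T"
    and rep: "\<And>i. i \<in> I \<Longrightarrow> T \<le> real (card {q \<in> Q. \<beta> i + q \<in> R})"
  shows "rich_bound (\<alpha> ` I) (512 * real (card Q) ^ 2 * real (card R) ^ 2 / T ^ 3)"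
  unfolding rich_bound_def
proof (intro allI impI)
  fix C :: "real set" and t :: real assume C: "finite C" and t: "0 < t"
  define X where "X = {x. t \<le> real (shift_count (\<alpha> ` I) C x)}"
  define IX where "IX = (\<lambda>x. {i \<in> I. \<alpha> i + x \<in> C})"
  have finI: "finite I" and inj: "inj_on \<alpha> I" "inj_on \<beta> I" using cv by (auto simp: curve_def)
  have finX: "finite X" unfolding X_def by (rule finite_rich) (use finI C t in auto)
  have finIX: "finite (IX x)" for x unfolding IX_def using finI by simp
  have sc: "shift_count (\<alpha> ` I) C x = card (IX x)" for x
  proof -
    have "{u \<in> \<alpha> ` I. u + x \<in> C} = \<alpha> ` IX x" by (auto simp: IX_def)
    moreover have "inj_on \<alpha> (IX x)" using inj(1) by (rule inj_on_subset) (auto simp: IX_def)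
    ultimately show ?thesis by (simp add: shift_count_def card_image)
  qed
  have tX: "t \<le> real (card (IX x))" if "x \<in> X" for x using that by (simp add: X_def sc)
  let ?c = "real (card C)" and ?q = "real (card Q)" and ?r = "real (card R)" and ?x = "real (card X)"
  have main: "?x * (t * T) ^ 3 \<le> 512 * ?q ^ 2 * ?r ^ 2 * ?c ^ 2"
  proof (cases "X = {}")
    case False
    then obtain x where x: "x \<in> X" by auto
    have tT: "t * T > 0" using t T by simp
    have "IX x \<noteq> {}" using tX[OF x] t by auto
    then obtain i where i: "i \<in> I" by (auto simp: IX_def)
    have TQ: "T \<le> ?q"
    proof -
      have "card {q \<in> Q. \<beta> i + q \<in> R} \<le> card Q" using fin by (intro card_mono) auto
      then show ?thesis using rep[OF i] by linarith
    qed
    have TR: "T \<le> ?r"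
    proof -
      have "card {q \<in> Q. \<beta> i + q \<in> R} \<le> card R"
        by (rule card_inj_on_le[where f = "\<lambda>q. \<beta> i + q"]) (use fin in \<open>auto simp: inj_on_def\<close>)
      then show ?thesis using rep[OF i] by linarith
    qed
    have qpos: "?q > 0" using T TQ by linarith
    have tC: "t \<le> ?c"
    proof -
      have "card (IX x) \<le> card C"
        by (rule card_inj_on_le[where f = "\<lambda>i. \<alpha> i + x"]) (use C inj(1) in \<open>auto simp: inj_on_def IX_def\<close>)
      then show ?thesis using tX[OF x] by linarith
    qed
    have tTsum: "t * T \<le> (\<Sum>q\<in>Q. real (card {i \<in> IX y. \<beta> i + q \<in> R}))" if y: "y \<in> X" for y
    proof -
      have "t * T \<le> real (card (IX y)) * T" using tX[OF y] T by (intro mult_right_mono) auto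
      also have "\<dots> = (\<Sum>i\<in>IX y. T)" by simp
      also have "\<dots> \<le> (\<Sum>i\<in>IX y. real (card {q \<in> Q. \<beta> i + q \<in> R}))"
        by (intro sum_mono rep) (auto simp: IX_def)
      also have "\<dots> = real (\<Sum>q\<in>Q. card {i \<in> IX y. \<beta> i + q \<in> R})"
        using double_count[OF finIX fin(1), where P = "\<lambda>i q. \<beta> i + q \<in> R"] by simp
      finally show ?thesis by simp
    qed
    have tTqr: "t * T \<le> ?q * ?r"
    proof -
      have "(\<Sum>q\<in>Q. real (card {i \<in> IX x. \<beta> i + q \<in> R})) \<le> (\<Sum>q\<in>Q. ?r)"
      proof (intro sum_mono of_nat_mono)
        fix q
        show "card {i \<in> IX x. \<beta> i + q \<in> R} \<le> card R"
          by (rule card_inj_on_le[where f = "\<lambda>i. \<beta> i + q"]) (use fin inj(2) in \<open>auto simp: inj_on_def IX_def\<close>)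
      qed
      then show ?thesis using tTsum[OF x] by simp
    qed
    have inc: "?x * (t * T) \<le> (\<Sum>(x, q)\<in>X \<times> Q. real (card {i \<in> I. \<alpha> i + x \<in> C \<and> \<beta> i + q \<in> R}))"
    proof -
      have "?x * (t * T) = (\<Sum>y\<in>X. t * T)" by simp
      also have "\<dots> \<le> (\<Sum>y\<in>X. \<Sum>q\<in>Q. real (card {i \<in> IX y. \<beta> i + q \<in> R}))"
        by (intro sum_mono tTsum)
      also have "\<dots> = (\<Sum>(y, q)\<in>X \<times> Q. real (card {i \<in> I. \<alpha> i + y \<in> C \<and> \<beta> i + q \<in> R}))"
        by (simp add: sum.cartesian_product IX_def conj_assoc)
      finally show ?thesis .
    qed
    \<comment> \<open>The optimal p is about t T / (4 |Q|). If this is below 1 no subdivision is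
      available, but then |X| t T \<le> |Q||R||C| together with (t T)^2 \<le> 4 |C||R||Q| is
      enough.\<close>
    show ?thesis
    proof (cases "t * T < 4 * ?q")
      case True
      have "?x * t \<le> real (card I) * ?c"
      proof -
        have "?x * t = (\<Sum>y\<in>X. t)" by simp
        also have "\<dots> \<le> (\<Sum>y\<in>X. real (shift_count (\<alpha> ` I) C y))" by (intro sum_mono) (auto simp: X_def)
        also have "\<dots> \<le> real (card (\<alpha> ` I)) * ?c" using finI C finX by (intro sum_shift_count_le) auto
        finally show ?thesis using inj by (simp add: card_image)
      qed
      moreover have "real (card I) * T \<le> ?q * ?r"
      proof -
        have "real (card I) * T = (\<Sum>i\<in>I. T)" by simp
        also have "\<dots> \<le> (\<Sum>i\<in>I. real (card {q \<in> Q. \<beta> i + q \<in> R}))" by (intro sum_mono rep)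
        also have "\<dots> = real (\<Sum>q\<in>Q. card {i \<in> I. \<beta> i + q \<in> R})"
          using double_count[OF finI fin(1), where P = "\<lambda>i q. \<beta> i + q \<in> R"] by simp
        also have "\<dots> \<le> real (\<Sum>q\<in>Q. card R)"
        proof (intro sum_mono of_nat_mono)
          fix q
          show "card {i \<in> I. \<beta> i + q \<in> R} \<le> card R"
            by (rule card_inj_on_le[where f = "\<lambda>i. \<beta> i + q"]) (use fin inj(2) in \<open>auto simp: inj_on_def\<close>)
        qed
        finally show ?thesis by simp
      qed
      ultimately have "?x * t * T \<le> real (card I) * ?c * T" "real (card I) * T * ?c \<le> ?q * ?r * ?c"
        using T by (auto intro!: mult_right_mono)
      then have "?x * t * T \<le> ?q * ?r * ?c" by (simp add: mult_ac)
      moreover have "(t * T) * (t * T) \<le> (?c * ?r) * (4 * ?q)"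
        by (rule mult_mono) (use True mult_mono[OF tC TR] t T tT in auto)
      ultimately have "(?x * t * T) * ((t * T) * (t * T)) \<le> (?q * ?r * ?c) * ((?c * ?r) * (4 * ?q))"
        by (rule mult_mono) auto
      also have "\<dots> = 4 * (?q ^ 2 * ?r ^ 2 * ?c ^ 2)" by (simp add: power2_eq_square)
      also have "\<dots> \<le> 512 * (?q ^ 2 * ?r ^ 2 * ?c ^ 2)" by (intro mult_right_mono) auto
      finally show ?thesis by (simp add: power3_eq_cube mult_ac)
    next
      case False
      \<comment> \<open>With this z the term 2 p |X||Q| is at most half of |X| t T and can be
        absorbed. Rounding down to p loses a factor 2, which turns 4 into 16; since (t T)^3 = 64
        |Q|^3 z^3, the final constant is 32 * 16 = 512.\<close>
      define z where "z = t * T / (4 * ?q)"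
      define p where "p = nat \<lfloor>z\<rfloor>"
      have z1: "1 \<le> z" using False qpos by (simp add: z_def field_simps)
      have p1: "1 \<le> p" using z1 by (simp add: p_def le_nat_floor)
      have pz: "real p \<le> z" using z1 by (simp add: p_def of_nat_floor)
      have zp: "z \<le> 2 * real p" using p1 z1 unfolding p_def by linarith
      have tqz: "t * T = 4 * ?q * z" using qpos by (simp add: z_def)
      have "t * T \<le> ?c * ?q" by (rule mult_mono) (use tC TQ t T in auto)
      then have "z \<le> ?c / 4" using qpos by (simp add: z_def field_simps)
      then have "real p \<le> ?c" using pz by linarith
      then have pC: "p \<le> card C" by simp
      have "z \<le> ?r / 4" using tTqr qpos by (simp add: z_def field_simps)
      then have "real p \<le> ?r" using pz by linarith
      then have pR: "p \<le> card R" by simp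
      have "?x * (t * T) \<le> 2 * real p * ?x * ?q + 4 * ?c ^ 2 * ?r ^ 2 / real p ^ 2"
        using inc curve_incidences_le[OF cv finX fin(1) C fin(2) p1 pC pR] by linarith
      also have "2 * real p * ?x * ?q \<le> 2 * z * ?x * ?q"
        using pz by (intro mult_right_mono) auto
      also have "4 * ?c ^ 2 * ?r ^ 2 / real p ^ 2 \<le> 4 * ?c ^ 2 * ?r ^ 2 / (z / 2) ^ 2"
        using zp z1 p1 by (intro divide_left_mono power_mono mult_pos_pos) auto
      finally have "?x * (4 * ?q * z) - 2 * z * ?x * ?q \<le> 16 * ?c ^ 2 * ?r ^ 2 / z ^ 2"
        using tqz by (simp add: power_divide)
      then have "2 * ?q * z * ?x * z ^ 2 \<le> 16 * ?c ^ 2 * ?r ^ 2"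
        using z1 by (simp add: field_simps)
      then have "32 * ?q ^ 2 * (2 * ?q * z * ?x * z ^ 2) \<le> 32 * ?q ^ 2 * (16 * ?c ^ 2 * ?r ^ 2)"
        by (intro mult_left_mono) auto
      then show ?thesis unfolding tqz by (simp add: power2_eq_square power3_eq_cube mult_ac)
    qed
  qed simp
  have "?x * t ^ 3 * T ^ 3 \<le> 512 * ?q ^ 2 * ?r ^ 2 * ?c ^ 2"
    using main by (simp add: power_mult_distrib mult.assoc)
  then show "real (card {x. t \<le> real (shift_count (\<alpha> ` I) C x)}) * t ^ 3
      \<le> 512 * ?q ^ 2 * ?r ^ 2 / T ^ 3 * ?c ^ 2"
    using T by (simp add: X_def field_simps)
qed

section \<open>Regularisation\<close>

text \<open>The share of the point u in the third energy: one of the three factors r(x) is expanded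
  as a sum over u.\<close>

definition energy_at :: "real set \<Rightarrow> real \<Rightarrow> real"
  where "energy_at U u = (\<Sum>x \<in> {x \<in> diffset U U. u + x \<in> U}. real (shift_count U U x) ^ 2)"

lemma energy_at_eq:
  "finite U \<Longrightarrow> energy_at U u = (\<Sum>x \<in> diffset U U. if u + x \<in> U then real (shift_count U U x) ^ 2 else 0)"
  unfolding energy_at_def by (rule sum.inter_filter) (rule finite_diffset)

lemma sum_energy_at:
  assumes "finite U"
  shows "(\<Sum>u\<in>U. energy_at U u) = energy 3 U"
proof -
  have "(\<Sum>u\<in>U. energy_at U u) = (\<Sum>x\<in>diffset U U. \<Sum>u\<in>U. if u + x \<in> U then real (shift_count U U x) ^ 2 else 0)"
    using assms by (simp add: energy_at_eq sum.swap[of _ U])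
  also have "\<dots> = (\<Sum>x\<in>diffset U U. real (shift_count U U x) ^ 3)"
  proof (rule sum.cong[OF refl])
    fix x
    have "(\<Sum>u\<in>U. if u + x \<in> U then real (shift_count U U x) ^ 2 else 0)
      = (\<Sum>u \<in> {u \<in> U. u + x \<in> U}. real (shift_count U U x) ^ 2)"
      by (rule sum.inter_filter[OF assms, symmetric])
    then show "(\<Sum>u\<in>U. if u + x \<in> U then real (shift_count U U x) ^ 2 else 0) = real (shift_count U U x) ^ 3"
      by (simp add: shift_count_def power2_eq_square power3_eq_cube)
  qed
  finally show ?thesis by (simp add: energy_def)
qed

text \<open>Deleting u lowers r(x) = n by at least one whenever \<open>u + x\<close> lies in U, and
  n^3 - (n - 1)^3 \<ge> n^2. Losses where u is the larger endpoint are discarded.\<close>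

lemma energy_remove_le:
  assumes "finite U" "u \<in> U"
  shows "energy 3 (U - {u}) \<le> energy 3 U - energy_at U u"
proof -
  let ?V = "U - {u}"
  have "energy 3 ?V = (\<Sum>x\<in>diffset ?V ?V. real (shift_count ?V ?V x) ^ 3)" by (simp add: energy_def)
  also have "\<dots> \<le> (\<Sum>x\<in>diffset U U. real (shift_count ?V ?V x) ^ 3)"
    using assms by (intro sum_mono2 finite_diffset diffset_mono) auto
  also have "\<dots> \<le> (\<Sum>x\<in>diffset U U. real (shift_count U U x) ^ 3 - (if u + x \<in> U then real (shift_count U U x) ^ 2 else 0))"
  proof (rule sum_mono)
    fix x
    let ?m = "shift_count ?V ?V x" and ?n = "shift_count U U x"
    show "real ?m ^ 3 \<le> real ?n ^ 3 - (if u + x \<in> U then real ?n ^ 2 else 0)"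
    proof (cases "u + x \<in> U")
      case True
      have fin: "finite {v \<in> U. v + x \<in> U}" using assms by simp
      have "?m \<le> card ({v \<in> U. v + x \<in> U} - {u})"
        unfolding shift_count_def using fin by (intro card_mono) auto
      also have "\<dots> = ?n - 1" unfolding shift_count_def using True assms by (subst card_Diff_singleton) auto
      finally have le: "?m \<le> ?n - 1" .
      have "{v \<in> U. v + x \<in> U} \<noteq> {}" using True assms by auto
      then have n1: "1 \<le> ?n" using fin by (auto simp: shift_count_def Suc_le_eq card_gt_0_iff)
      define a where "a = real ?n"
      have "real ?m \<le> a - 1" using le n1 unfolding a_def by linarith
      then have "real ?m ^ 3 \<le> (a - 1) ^ 3" by (intro power_mono) auto
      also have "\<dots> = (a - 1) * (a - 1) ^ 2" by (simp add: power3_eq_cube power2_eq_square)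
      also have "\<dots> \<le> (a - 1) * a ^ 2" using n1 by (intro mult_left_mono power_mono) (auto simp: a_def)
      also have "\<dots> = a ^ 3 - a ^ 2" by (simp add: power3_eq_cube power2_eq_square algebra_simps)
      finally show ?thesis using True by (simp add: a_def)
    next
      case False
      have "?m \<le> ?n" using assms by (intro shift_count_mono) auto
      then show ?thesis using False by (auto intro!: power_mono)
    qed
  qed
  also have "\<dots> = energy 3 U - energy_at U u"
    using assms by (simp add: sum_subtractf energy_def energy_at_eq)
  finally show ?thesis .
qed

lemma energy3_le:
  assumes "finite U"
  shows "energy 3 U \<le> real (card U) ^ 4"
proof -
  have "energy 3 U \<le> (\<Sum>x\<in>diffset U U. real (card U) ^ 2 * real (shift_count U U x))"
    unfolding energy_def
  proof (rule sum_mono)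
    fix x
    have "real (shift_count U U x) ^ 2 \<le> real (card U) ^ 2"
      using shift_count_le[OF assms, of U x] by (intro power_mono) auto
    then have "real (shift_count U U x) ^ 2 * real (shift_count U U x) \<le> real (card U) ^ 2 * real (shift_count U U x)"
      by (intro mult_right_mono) auto
    then show "real (shift_count U U x) ^ 3 \<le> real (card U) ^ 2 * real (shift_count U U x)"
      by (simp add: power3_eq_cube power2_eq_square)
  qed
  also have "\<dots> = real (card U) ^ 2 * (\<Sum>x\<in>diffset U U. real (shift_count U U x))"
    by (simp add: sum_distrib_left)
  also have "\<dots> \<le> real (card U) ^ 2 * (real (card U) * real (card U))"
    using assms by (intro mult_left_mono sum_shift_count_le finite_diffset) auto
  finally show ?thesis by (simp add: power2_eq_square power4_eq_xxxx)
qed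

lemma energy_at_nonneg: "0 \<le> energy_at U u"
  unfolding energy_at_def by (intro sum_nonneg) auto

text \<open>Minimising \<open>energy 3 V / |V| ^ L\<close> makes every point carry at most an \<open>L / n\<close> share of the
  energy, since otherwise deleting it would decrease the quotient.\<close>

lemma exists_energy_regular_subset:
  assumes "finite U" "U \<noteq> {}" "card U \<le> 2 ^ L" "1 \<le> L"
  obtains V where "V \<subseteq> U" "V \<noteq> {}" "real (card U) \<le> 16 * real (card V)"
    "\<And>u. u \<in> V \<Longrightarrow> real (card V) * energy_at V u \<le> real L * energy 3 V"
proof -
  define \<phi> where "\<phi> = (\<lambda>V. energy 3 V / real (card V) ^ L)"
  define F where "F = Pow U - {{}}"
  define V where "V = arg_min_on \<phi> F"
  have F: "finite F" "F \<noteq> {}" using assms by (auto simp: F_def)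
  have VF: "V \<in> F" unfolding V_def by (rule arg_min_if_finite(1)[OF F])
  have min: "\<phi> V \<le> \<phi> W" if "W \<in> F" for W
    using arg_min_if_finite(2)[OF F, of \<phi>] that unfolding V_def by (meson not_le)
  have V: "V \<subseteq> U" "V \<noteq> {}" using VF by (auto simp: F_def)
  have finV: "finite V" using V assms finite_subset by blast
  define n where "n = real (card V)"
  define N where "N = real (card U)"
  have n1: "n \<ge> 1" unfolding n_def using V finV by (simp add: Suc_le_eq card_gt_0_iff)
  have N1: "N \<ge> 1" unfolding N_def using assms by (simp add: Suc_le_eq card_gt_0_iff)
  have N2: "N \<le> 2 ^ L" unfolding N_def using assms(3) by (metis of_nat_le_iff of_nat_numeral of_nat_power)
  have EV: "energy 3 V \<ge> 1" using energy_pos finV V by blast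
  \<comment> \<open>Comparison with U itself. The exponent L is chosen for this step: N^4 \<le> 16^L
    becomes a constant factor after taking L-th roots.\<close>
  have size: "N \<le> 16 * n"
  proof -
    have "\<phi> V \<le> \<phi> U" using assms by (intro min) (auto simp: F_def)
    then have "1 / n ^ L \<le> N ^ 4 / N ^ L"
      using EV energy3_le[OF assms(1)] n1 N1 unfolding \<phi>_def n_def[symmetric] N_def[symmetric]
      by (smt (verit, best) divide_right_mono zero_le_power)
    then have "N ^ L \<le> N ^ 4 * n ^ L" using n1 N1 by (simp add: field_simps)
    also have "\<dots> \<le> (2 ^ L) ^ 4 * n ^ L" using N2 N1 n1 by (intro mult_right_mono power_mono) auto
    also have "\<dots> = (16 * n) ^ L"
    proof -
      have "((2::real) ^ L) ^ 4 = (2 ^ 4) ^ L" by (simp only: mult.commute flip: power_mult)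
      then show ?thesis by (simp add: power_mult_distrib)
    qed
    finally show ?thesis using assms(4) n1 N1 by (subst (asm) power_mono_iff) auto
  qed
  \<comment> \<open>A singleton is treated apart, because deleting its point leaves the empty set,
    which is not a competitor in \<open>F\<close>.\<close>
  have deg: "n * energy_at V u \<le> real L * energy 3 V" if u: "u \<in> V" for u
  proof (cases "card V = 1")
    case True
    have "energy_at V u \<le> (\<Sum>u\<in>V. energy_at V u)"
      using u finV energy_at_nonneg by (intro member_le_sum) auto
    also have "\<dots> = energy 3 V" by (rule sum_energy_at[OF finV])
    also have "\<dots> \<le> real L * energy 3 V" using assms(4) EV by (simp add: mult_le_cancel_right1)
    finally show ?thesis using True by (simp add: n_def)
  next
    case False
    let ?W = "V - {u}"
    have cW: "card ?W = card V - 1" using u finV by simp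
    have "card V \<ge> 2" using False n1 unfolding n_def by linarith
    then have cW': "real (card ?W) = n - 1" and n2: "n \<ge> 2" unfolding n_def cW by linarith+
    have Wne: "?W \<noteq> {}" using cW' n2 by force
    have "\<phi> V \<le> \<phi> ?W" using V Wne by (intro min) (auto simp: F_def)
    then have "energy 3 V / n ^ L \<le> energy 3 ?W / (n - 1) ^ L" by (simp add: \<phi>_def cW' n_def)
    then have "energy 3 V * ((n - 1) / n) ^ L \<le> energy 3 ?W"
      using n2 by (simp add: field_simps power_divide)
    also have "\<dots> \<le> energy 3 V - energy_at V u" by (rule energy_remove_le[OF finV u])
    finally have 1: "energy_at V u \<le> energy 3 V - energy 3 V * ((n - 1) / n) ^ L" by simp
    \<comment> \<open>Deleting one point changes the denominator by the factor (1 - 1/n)^L;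
      Bernoulli turns minimality into the share L / n.\<close>
    have "1 + real L * (- 1 / n) \<le> (1 + - 1 / n) ^ L" using n2 by (intro Bernoulli_inequality) (simp add: field_simps)
    moreover have "1 + - 1 / n = (n - 1) / n" using n2 by (simp add: field_simps)
    ultimately have "1 - real L / n \<le> ((n - 1) / n) ^ L" by simp
    then have "energy 3 V * (1 - real L / n) \<le> energy 3 V * ((n - 1) / n) ^ L"
      using EV by (intro mult_left_mono) auto
    with 1 have "energy_at V u \<le> energy 3 V * (real L / n)" by (simp add: algebra_simps)
    then show ?thesis using n2 by (simp add: field_simps)
  qed
  show thesis
    by (rule that[OF V]) (use size deg in \<open>auto simp: n_def N_def\<close>)
qed

section \<open>Cross bounds between the two coordinates\<close>

text \<open>Supplies the hypothesis of the incidence bound: one level set X and one threshold T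
  valid for every element of G. Each heavy point has its own dominant dyadic level, and a second
  pigeonholing over levels makes the choice common. In the last inequality the level has cancelled,
  so only the energy and |V| remain.\<close>

lemma exists_popular_shifts:
  assumes "finite U" "U \<noteq> {}" "card U \<le> 2 ^ L" "1 \<le> L"
  obtains V G X T where "G \<subseteq> V" "V \<subseteq> U" "finite X" "0 < (T::real)"
    "real (card U) \<le> 64 * real L ^ 2 * real (card G)" "real (card V) \<le> 4 * real L ^ 2 * real (card G)"
    "\<And>u. u \<in> G \<Longrightarrow> T \<le> real (card {x \<in> X. u + x \<in> V})"
    "real (card X) ^ 2 * energy 3 V \<le> 2 ^ 12 * real L ^ 3 * real (card V) ^ 3 * T ^ 3"
proof -
  obtain V where V: "V \<subseteq> U" "V \<noteq> {}" "real (card U) \<le> 16 * real (card V)"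
    "\<And>u. u \<in> V \<Longrightarrow> real (card V) * energy_at V u \<le> real L * energy 3 V"
    using exists_energy_regular_subset[OF assms] by metis
  have finV: "finite V" using V assms finite_subset by blast
  define E where "E = energy 3 V"
  define n where "n = real (card V)"
  define l where "l = real L"
  have E1: "E \<ge> 1" using energy_pos finV V E_def by blast
  have n1: "n \<ge> 1" unfolding n_def using V finV by (simp add: Suc_le_eq card_gt_0_iff)
  have l1: "l \<ge> 1" using assms(4) by (simp add: l_def)
  have VL: "card V \<le> 2 ^ L" using card_mono[OF assms(1) V(1)] assms(3) by linarith
  \<comment> \<open>Points with at least half the average share carry at least half of E. As no
    share exceeds L E / n, there are at least n / (2 L) of them.\<close>
  define G0 where "G0 = {u \<in> V. E / (2 * n) \<le> energy_at V u}"
  have finG0: "finite G0" using finV by (simp add: G0_def)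
  have G0: "n \<le> 2 * l * real (card G0)"
  proof -
    have "E = (\<Sum>u\<in>V. energy_at V u)" by (simp add: E_def sum_energy_at[OF finV])
    also have "\<dots> = (\<Sum>u\<in>G0. energy_at V u) + (\<Sum>u\<in>V - G0. energy_at V u)"
      using finV by (subst sum.subset_diff[of G0]) (auto simp: G0_def)
    also have "(\<Sum>u\<in>G0. energy_at V u) \<le> (\<Sum>u\<in>G0. l * E / n)"
      using V(4) n1 by (intro sum_mono) (auto simp: G0_def n_def E_def l_def field_simps)
    also have "(\<Sum>u\<in>V - G0. energy_at V u) \<le> (\<Sum>u\<in>V - G0. E / (2 * n))"
      by (intro sum_mono) (auto simp: G0_def)
    also have "(\<Sum>u\<in>V - G0. E / (2 * n)) \<le> (\<Sum>u\<in>V. E / (2 * n))"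
      using finV E1 n1 by (intro sum_mono2) auto
    also have "\<dots> = E / 2" using n1 by (simp add: n_def)
    finally have "E \<le> real (card G0) * (l * E / n) + E / 2" by simp
    then have "E * n \<le> E * (2 * l * real (card G0))" using n1 by (simp add: field_simps)
    then show ?thesis using E1 by simp
  qed
  define X where "X = (\<lambda>k. {x \<in> diffset V V. 2 ^ k \<le> shift_count V V x \<and> shift_count V V x < 2 ^ (k + 1)})"
  \<comment> \<open>Solves E / (2 n) \<le> 2 L * 4 * (2^k)^2 * m for m: half the average share, at
    most 2 L levels, and the factor 4 from the dyadic rounding.\<close>
  define T where "T = (\<lambda>k. E / (16 * n * l * (2 ^ k) ^ 2))"
  define G where "G = (\<lambda>k. {u \<in> G0. T k \<le> real (card {x \<in> X k. u + x \<in> V})})"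
  have finX: "finite (X k)" for k unfolding X_def using finite_diffset[OF finV finV] by auto
  have ex: "\<exists>k\<le>L. u \<in> G k" if u: "u \<in> G0" for u
  proof -
    let ?Y = "{x \<in> diffset V V. u + x \<in> V}"
    have "energy_at V u \<le> (\<Sum>k\<le>L. 2 ^ 2 * (2 ^ k) ^ 2 * real (card {x \<in> ?Y. 2 ^ k \<le> shift_count V V x \<and> shift_count V V x < 2 ^ (k + 1)}))"
      unfolding energy_at_def using finite_diffset[OF finV finV]
      by (intro sum_power_le_dyadic order_trans[OF shift_count_le[OF finV] VL]) auto
    moreover have "E / (2 * n) \<le> energy_at V u" using u by (simp add: G0_def)
    ultimately have "E / (2 * n) \<le> (\<Sum>k\<le>L. 2 ^ 2 * (2 ^ k) ^ 2 * real (card {x \<in> ?Y. 2 ^ k \<le> shift_count V V x \<and> shift_count V V x < 2 ^ (k + 1)}))"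
      by linarith
    then obtain k where k: "k \<le> L" "E / (2 * n) \<le> real (L + 1) * (2 ^ 2 * (2 ^ k) ^ 2 * real (card {x \<in> ?Y. 2 ^ k \<le> shift_count V V x \<and> shift_count V V x < 2 ^ (k + 1)}))"
      by (rule sum_atMost_pigeonhole)
    have eq: "{x \<in> ?Y. 2 ^ k \<le> shift_count V V x \<and> shift_count V V x < 2 ^ (k + 1)} = {x \<in> X k. u + x \<in> V}"
      by (auto simp: X_def)
    define m where "m = real (card {x \<in> X k. u + x \<in> V})"
    define b where "b = ((2::real) ^ k) ^ 2"
    have bp: "b > 0" by (simp add: b_def)
    have "E / (2 * n) \<le> real (L + 1) * (4 * b * m)"
      using k(2) unfolding eq m_def b_def by simp
    also have "\<dots> \<le> (2 * l) * (4 * b * m)"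
      using assms(4) bp by (intro mult_right_mono) (auto simp: l_def m_def)
    finally have "T k \<le> m" using n1 l1 bp unfolding T_def b_def[symmetric] by (simp add: field_simps)
    then show ?thesis using k(1) u by (auto simp: G_def m_def)
  qed
  have "card G0 \<le> card (\<Union>k\<le>L. G k)" using ex finG0 by (intro card_mono) (auto simp: G_def)
  also have "\<dots> \<le> (\<Sum>k\<le>L. card (G k))" by (rule card_UN_le) simp
  finally have "real (card G0) \<le> real (\<Sum>k\<le>L. card (G k))" by (rule of_nat_mono)
  then have "real (card G0) \<le> (\<Sum>k\<le>L. real (card (G k)))" by simp
  then obtain k where k: "k \<le> L" "real (card G0) \<le> real (L + 1) * real (card (G k))"
    by (rule sum_atMost_pigeonhole)
  have "real (card G0) \<le> 2 * l * real (card (G k))"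
    using k(2) assms(4) by (smt (verit) l_def mult_right_mono of_nat_0_le_iff of_nat_1 of_nat_add of_nat_mono)
  then have "2 * l * real (card G0) \<le> 2 * l * (2 * l * real (card (G k)))"
    using l1 by (intro mult_left_mono) auto
  then have nG: "n \<le> 4 * l ^ 2 * real (card (G k))" using G0 by (simp add: power2_eq_square)
  show thesis
  proof (rule that[of "G k" V "X k" "T k"])
    show "G k \<subseteq> V" by (auto simp: G_def G0_def)
    show "0 < T k" using E1 n1 l1 by (simp add: T_def)
    show "real (card U) \<le> 64 * (real L)\<^sup>2 * real (card (G k))" "real (card V) \<le> 4 * (real L)\<^sup>2 * real (card (G k))"
      using nG V(3) by (auto simp: n_def l_def)
    show "T k \<le> real (card {x \<in> X k. u + x \<in> V})" if "u \<in> G k" for u using that by (simp add: G_def)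
    have "real (card (X k)) * (2 ^ k) ^ 3 = (\<Sum>x\<in>X k. (2 ^ k) ^ 3)" by simp
    also have "\<dots> \<le> (\<Sum>x\<in>X k. real (shift_count V V x) ^ 3)"
    proof (intro sum_mono power_mono)
      fix x assume "x \<in> X k"
      then have "real (2 ^ k) \<le> real (shift_count V V x)" unfolding X_def by (intro of_nat_mono) simp
      then show "2 ^ k \<le> real (shift_count V V x)" by simp
    qed auto
    also have "\<dots> \<le> E" unfolding E_def by (intro sum_le_energy finV finX) simp
    finally have XE: "real (card (X k)) * (2 ^ k) ^ 3 \<le> E" .
    define b where "b = (2::real) ^ k"
    have bp: "b > 0" by (simp add: b_def)
    \<comment> \<open>Squaring |X| b^3 \<le> E produces b^6, the same power of the level as in T^3,
      so the unknown k drops out.\<close>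
    have "(real (card (X k)) * b ^ 3) ^ 2 \<le> E ^ 2" using XE unfolding b_def by (intro power_mono) auto
    then have "real (card (X k)) ^ 2 * b ^ 6 \<le> E ^ 2" by (simp add: power_mult_distrib flip: power_mult)
    then have "real (card (X k)) ^ 2 * b ^ 6 * E \<le> E ^ 2 * E" using E1 by (intro mult_right_mono) auto
    then have "real (card (X k)) ^ 2 * E \<le> E ^ 3 / b ^ 6" using bp by (simp add: field_simps power3_eq_cube power2_eq_square)
    also have "\<dots> = 2 ^ 12 * l ^ 3 * n ^ 3 * T k ^ 3"
    proof -
      have "T k ^ 3 = E ^ 3 / (16 ^ 3 * n ^ 3 * l ^ 3 * b ^ 6)"
        unfolding T_def b_def[symmetric] by (simp add: power_divide power_mult_distrib flip: power_mult)
      then show ?thesis using n1 l1 bp by simp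
    qed
    finally show "real (card (X k)) ^ 2 * energy 3 V \<le> 2 ^ 12 * real L ^ 3 * real (card V) ^ 3 * T k ^ 3"
      by (simp add: E_def l_def n_def)
  qed (use V finX in auto)
qed

text \<open>The incidence bound with Q = X and R = V and the coordinates exchanged. Its constant
  |X|^2 |V|^2 / T^3 times the energy is free of the level by the last property of the popular
  shifts, leaving |V|^5 up to logarithms.\<close>

lemma exists_subcurve_rich_bound:
  fixes \<alpha> \<beta> :: "'i \<Rightarrow> real"
  assumes cv: "curve I \<alpha> \<beta>" and "I \<noteq> {}" "card I \<le> 2 ^ L" "1 \<le> L"
  obtains J \<sigma> where "J \<subseteq> I" "real (card I) \<le> 64 * real L ^ 2 * real (card J)"
    "rich_bound (\<beta> ` J) \<sigma>" "energy 3 (\<alpha> ` J) * \<sigma> \<le> 2 ^ 31 * real L ^ 13 * real (card J) ^ 5"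
proof -
  have finI: "finite I" and inj: "inj_on \<alpha> I" using cv by (auto simp: curve_def)
  have cI: "card (\<alpha> ` I) = card I" using inj by (rule card_image)
  obtain V G X T where *: "G \<subseteq> V" "V \<subseteq> \<alpha> ` I" "finite X" "0 < (T::real)"
    "real (card I) \<le> 64 * real L ^ 2 * real (card G)" "real (card V) \<le> 4 * real L ^ 2 * real (card G)"
    "\<And>u. u \<in> G \<Longrightarrow> T \<le> real (card {x \<in> X. u + x \<in> V})"
    "real (card X) ^ 2 * energy 3 V \<le> 2 ^ 12 * real L ^ 3 * real (card V) ^ 3 * T ^ 3"
    by (rule exists_popular_shifts[of "\<alpha> ` I" L, unfolded cI]) (use finI assms in auto)
  have finV: "finite V" using *(2) finI finite_surj by blast
  define J where "J = {i \<in> I. \<alpha> i \<in> G}"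
  have JI: "J \<subseteq> I" by (auto simp: J_def)
  have aJ: "\<alpha> ` J = G" using *(1,2) by (auto simp: J_def)
  have cJ: "card J = card G" using card_image[OF inj_on_subset[OF inj JI]] aJ by simp
  have rb: "rich_bound (\<beta> ` J) (512 * real (card X) ^ 2 * real (card V) ^ 2 / T ^ 3)"
    by (rule rich_bound_of_curve[OF curve_swap[OF curve_subset[OF cv JI]]])
      (use * finV in \<open>auto simp: J_def\<close>)
  have "energy 3 (\<alpha> ` J) * (512 * real (card X) ^ 2 * real (card V) ^ 2 / T ^ 3)
    \<le> energy 3 V * (512 * real (card X) ^ 2 * real (card V) ^ 2 / T ^ 3)"
    unfolding aJ using *(1,4) finV by (intro mult_right_mono energy_mono) auto
  also have "\<dots> = 512 * real (card V) ^ 2 * (real (card X) ^ 2 * energy 3 V) / T ^ 3" by simp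
  also have "\<dots> \<le> 512 * real (card V) ^ 2 * (2 ^ 12 * real L ^ 3 * real (card V) ^ 3 * T ^ 3) / T ^ 3"
    using *(4,8) by (intro divide_right_mono mult_left_mono) auto
  also have "\<dots> = 2 ^ 21 * real L ^ 3 * real (card V) ^ 5" using *(4) by (simp flip: power_add)
  also have "\<dots> \<le> 2 ^ 21 * real L ^ 3 * (4 * real L ^ 2 * real (card G)) ^ 5"
    using *(6) by (intro mult_left_mono power_mono) auto
  also have "\<dots> = 2 ^ 31 * real L ^ 13 * real (card J) ^ 5"
    by (simp add: cJ power_mult_distrib flip: power_mult power_add)
  finally show thesis using that[OF JI _ rb] *(5) cJ by simp
qed

text \<open>Two passes with the coordinates exchanged. The first bound survives the second pass
  because energies and rich bounds are inherited by subsets; only \<open>card K\<close> on the right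
  must be replaced by 64 L^2 |J|, whence 2^31 * 64^5 = 2^61 and L^23.\<close>

theorem exists_regular_subcurve:
  fixes \<alpha> \<beta> :: "'i \<Rightarrow> real"
  assumes cv: "curve I \<alpha> \<beta>" and "I \<noteq> {}" "card I \<le> 2 ^ L" "1 \<le> L"
  obtains J \<sigma> \<tau> where "J \<subseteq> I" "real (card I) \<le> 2 ^ 12 * real L ^ 4 * real (card J)"
    "rich_bound (\<alpha> ` J) \<sigma>" "rich_bound (\<beta> ` J) \<tau>"
    "energy 3 (\<alpha> ` J) * \<tau> \<le> 2 ^ 61 * real L ^ 23 * real (card J) ^ 5"
    "energy 3 (\<beta> ` J) * \<sigma> \<le> 2 ^ 61 * real L ^ 23 * real (card J) ^ 5"
proof -
  have finI: "finite I" using cv by (auto simp: curve_def)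
  have l1: "real L \<ge> 1" using assms(4) by simp
  obtain K \<tau> where K: "K \<subseteq> I" "real (card I) \<le> 64 * real L ^ 2 * real (card K)"
    "rich_bound (\<beta> ` K) \<tau>" "energy 3 (\<alpha> ` K) * \<tau> \<le> 2 ^ 31 * real L ^ 13 * real (card K) ^ 5"
    by (rule exists_subcurve_rich_bound[OF assms])
  have finK: "finite K" using K finI finite_subset by blast
  have "card I > 0" using finI assms(2) by (simp add: card_gt_0_iff)
  then have Kne: "K \<noteq> {}" using K(2) by auto
  have KL: "card K \<le> 2 ^ L" using card_mono[OF finI K(1)] assms(3) by linarith
  obtain J \<sigma> where J: "J \<subseteq> K" "real (card K) \<le> 64 * real L ^ 2 * real (card J)"
    "rich_bound (\<alpha> ` J) \<sigma>" "energy 3 (\<beta> ` J) * \<sigma> \<le> 2 ^ 31 * real L ^ 13 * real (card J) ^ 5"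
    by (rule exists_subcurve_rich_bound[OF curve_swap[OF curve_subset[OF cv K(1)]] Kne KL assms(4)])
  show thesis
  proof (rule that)
    show "J \<subseteq> I" using J(1) K(1) by blast
    have "real (card I) \<le> 64 * real L ^ 2 * (64 * real L ^ 2 * real (card J))"
      by (rule order_trans[OF K(2)]) (intro mult_left_mono J(2), simp)
    also have "\<dots> = 2 ^ 12 * real L ^ 4 * real (card J)" by (simp flip: power_add)
    finally show "real (card I) \<le> 2 ^ 12 * real L ^ 4 * real (card J)" .
    show "rich_bound (\<alpha> ` J) \<sigma>" by fact
    show "rich_bound (\<beta> ` J) \<tau>"
      by (rule rich_bound_mono[OF K(3)]) (use J(1) finK in auto)
    have "energy 3 (\<alpha> ` J) * \<tau> \<le> energy 3 (\<alpha> ` K) * \<tau>"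
      using J(1) finK rich_bound_nonneg[OF K(3)] by (intro mult_right_mono energy_mono) auto
    also have "\<dots> \<le> 2 ^ 31 * real L ^ 13 * real (card K) ^ 5" by (rule K(4))
    also have "\<dots> \<le> 2 ^ 31 * real L ^ 13 * (64 * real L ^ 2 * real (card J)) ^ 5"
      using J(2) by (intro mult_left_mono power_mono) auto
    also have "\<dots> = 2 ^ 61 * real L ^ 23 * real (card J) ^ 5"
      by (simp add: power_mult_distrib flip: power_mult power_add)
    finally show "energy 3 (\<alpha> ` J) * \<tau> \<le> 2 ^ 61 * real L ^ 23 * real (card J) ^ 5" .
    have "2 ^ 31 * real L ^ 13 * real (card J) ^ 5 \<le> 2 ^ 61 * real L ^ 23 * real (card J) ^ 5"
      using l1 by (intro mult_right_mono mult_mono power_increasing) auto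
    then show "energy 3 (\<beta> ` J) * \<sigma> \<le> 2 ^ 61 * real L ^ 23 * real (card J) ^ 5"
      using J(4) by linarith
  qed
qed

section \<open>Popular sums\<close>

text \<open>Cauchy-Schwarz over the fibre sizes, whose squares count the coinciding pairs.\<close>

lemma card_squared_le_fibres:
  assumes "finite A" "finite Z" "\<phi> ` A \<subseteq> Z"
  shows "real (card A) ^ 2 \<le> real (card Z) * real (card {(s, s'). s \<in> A \<and> s' \<in> A \<and> \<phi> s = \<phi> s'})"
proof -
  define F where "F = (\<lambda>z. {s \<in> A. \<phi> s = z})"
  have finF: "finite (F z)" for z using assms by (simp add: F_def)
  have finP: "finite {(s, s'). s \<in> A \<and> s' \<in> A \<and> \<phi> s = \<phi> s'}"
    by (rule finite_subset[of _ "A \<times> A"]) (use assms in auto)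
  have "card A \<le> card (SIGMA z:Z. F z)"
    by (rule card_inj_on_le[where f = "\<lambda>s. (\<phi> s, s)"]) (use assms finF in \<open>auto simp: inj_on_def F_def\<close>)
  then have "card A \<le> (\<Sum>z\<in>Z. card (F z))" using assms finF by (simp add: card_SigmaI)
  then have "real (card A) \<le> real (\<Sum>z\<in>Z. card (F z))" by (rule of_nat_mono)
  then have "real (card A) ^ 2 \<le> (\<Sum>z\<in>Z. 1 * real (card (F z))) ^ 2" by (intro power_mono) auto
  also have "\<dots> \<le> (\<Sum>z\<in>Z. 1 ^ 2) * (\<Sum>z\<in>Z. real (card (F z)) ^ 2)" by (rule Cauchy_Schwarz_ineq_sum)
  also have "\<dots> = real (card Z) * real (\<Sum>z\<in>Z. card (F z) ^ 2)" by simp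
  also have "(\<Sum>z\<in>Z. card (F z) ^ 2) = card (SIGMA z:Z. F z \<times> F z)"
    using assms finF by (simp add: card_SigmaI card_cartesian_product power2_eq_square)
  also have "real (card Z) * real (card (SIGMA z:Z. F z \<times> F z))
      \<le> real (card Z) * real (card {(s, s'). s \<in> A \<and> s' \<in> A \<and> \<phi> s = \<phi> s'})"
  proof (intro mult_left_mono of_nat_mono)
    show "card (SIGMA z:Z. F z \<times> F z) \<le> card {(s, s'). s \<in> A \<and> s' \<in> A \<and> \<phi> s = \<phi> s'}"
      by (rule card_inj_on_le[where f = snd]) (use finP in \<open>auto simp: inj_on_def F_def\<close>)
  qed simp
  finally show ?thesis .
qed

text \<open>Sums with fewer than |U||V| / (16 |U + V|) representations account for at most a
  sixteenth of all pairs (a, b). By Markov at most a quarter of U has more than |V| / 4 unpopular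
  partners; two of the remaining elements still share half of V.\<close>

lemma exists_popular_sums:
  assumes "finite U" "finite V" "U \<noteq> {}" "V \<noteq> {}"
  obtains U' P where "U' \<subseteq> U" "card U \<le> 2 * card U'" "P \<subseteq> sumset U V"
    "\<And>s. s \<in> P \<Longrightarrow> real (card U) * real (card V) \<le> 16 * real (card (sumset U V)) * real (card {a \<in> U. s - a \<in> V})"
    "\<And>a a'. a \<in> U' \<Longrightarrow> a' \<in> U' \<Longrightarrow> real (card V) \<le> 2 * real (card {b \<in> V. a + b \<in> P \<and> a' + b \<in> P})"
proof -
  define S where "S = sumset U V"
  define s where "s = real (card S)"
  define u where "u = real (card U)"
  define v where "v = real (card V)"
  have finS: "finite S" unfolding S_def using assms by (intro finite_sumset)
  have uv: "u > 0" "v > 0" using assms by (auto simp: u_def v_def card_gt_0_iff)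
  obtain a0 b0 where "a0 \<in> U" "b0 \<in> V" using assms by auto
  then have "a0 + b0 \<in> S" unfolding S_def sumset_def by blast
  then have sp: "s > 0" using finS by (auto simp: s_def card_gt_0_iff)
  define P where "P = {w \<in> S. u * v \<le> 16 * s * real (card {a \<in> U. w - a \<in> V})}"
  define Bad where "Bad = (\<lambda>a. {b \<in> V. a + b \<notin> P})"
  define U' where "U' = {a \<in> U. 4 * real (card (Bad a)) \<le> v}"
  have finB: "finite (Bad a)" for a using assms by (simp add: Bad_def)
  have "card (SIGMA a:U. Bad a) \<le> card (SIGMA w:S - P. {a \<in> U. w - a \<in> V})"
    by (rule card_inj_on_le[where f = "\<lambda>(a, b). (a + b, a)"])
      (use assms finS in \<open>auto simp: inj_on_def Bad_def S_def sumset_def\<close>)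
  then have "(\<Sum>a\<in>U. card (Bad a)) \<le> (\<Sum>w\<in>S - P. card {a \<in> U. w - a \<in> V})"
    using assms finS finB by (simp add: card_SigmaI)
  then have "real (\<Sum>a\<in>U. card (Bad a)) \<le> real (\<Sum>w\<in>S - P. card {a \<in> U. w - a \<in> V})" by (rule of_nat_mono)
  also have "\<dots> = (\<Sum>w\<in>S - P. real (card {a \<in> U. w - a \<in> V}))" by simp
  also have "\<dots> \<le> (\<Sum>w\<in>S - P. u * v / (16 * s))"
    using sp by (intro sum_mono) (auto simp: P_def field_simps)
  also have "\<dots> \<le> (\<Sum>w\<in>S. u * v / (16 * s))" using finS uv sp by (intro sum_mono2) auto
  also have "\<dots> = u * v / 16" using sp by (simp add: s_def)
  finally have bad: "(\<Sum>a\<in>U. real (card (Bad a))) \<le> u * v / 16" by simp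
  have "real (card (U - U')) * (v / 4) = (\<Sum>a\<in>U - U'. v / 4)" by simp
  also have "\<dots> \<le> (\<Sum>a\<in>U - U'. real (card (Bad a)))" by (intro sum_mono) (auto simp: U'_def)
  also have "\<dots> \<le> (\<Sum>a\<in>U. real (card (Bad a)))" using assms by (intro sum_mono2) auto
  finally have "real (card (U - U')) * v \<le> (u / 4) * v" using bad by simp
  then have "real (card (U - U')) \<le> u / 4" using uv by simp
  moreover have "card U = card U' + card (U - U')"
    using assms by (subst card_Diff_subset) (auto simp: U'_def card_mono intro: finite_subset)
  ultimately have half: "card U \<le> 2 * card U'" unfolding u_def by linarith
  have common: "v \<le> 2 * real (card {b \<in> V. a + b \<in> P \<and> a' + b \<in> P})" if "a \<in> U'" "a' \<in> U'" for a a'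
  proof -
    have "card V \<le> card ({b \<in> V. a + b \<in> P \<and> a' + b \<in> P} \<union> (Bad a \<union> Bad a'))"
      using assms by (intro card_mono) (auto simp: Bad_def)
    also have "\<dots> \<le> card {b \<in> V. a + b \<in> P \<and> a' + b \<in> P} + card (Bad a \<union> Bad a')" by (rule card_Un_le)
    also have "card (Bad a \<union> Bad a') \<le> card (Bad a) + card (Bad a')" by (rule card_Un_le)
    finally have "card V \<le> card {b \<in> V. a + b \<in> P \<and> a' + b \<in> P} + (card (Bad a) + card (Bad a'))" by simp
    then have "v \<le> real (card {b \<in> V. a + b \<in> P \<and> a' + b \<in> P}) + (real (card (Bad a)) + real (card (Bad a')))"
      unfolding v_def by linarith
    moreover have "4 * real (card (Bad a)) \<le> v" "4 * real (card (Bad a')) \<le> v" using that by (auto simp: U'_def)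
    ultimately show ?thesis by linarith
  qed
  show thesis
  proof (rule that[of U' P])
    show "U' \<subseteq> U" by (auto simp: U'_def)
    show "P \<subseteq> sumset U V" by (auto simp: P_def S_def)
  qed (use half common in \<open>auto simp: P_def S_def u_def v_def s_def\<close>)
qed

text \<open>A popular u has \<Delta> decompositions u = a + b, and u - v = d turns each into d - a =
  b - v. Sorting by the common value y pairs the shift counts of U in D with those of V in P.
  Hoelder takes first and third moments of the former and the third moment of the latter, which
  explains the powers 3 + 2 = 5 of |D| and 4 of |P|.\<close>

lemma card_popular_differences_le:
  assumes fin: "finite U" "finite V" "finite D" "finite P"
    and rb: "rich_bound U \<sigma>" "rich_bound V \<tau>" and L: "card U \<le> 2 ^ L" "card V \<le> 2 ^ L" "1 \<le> L"
    and pop: "\<And>s. s \<in> P \<Longrightarrow> \<Delta> \<le> real (card {a \<in> U. s - a \<in> V})" and \<Delta>: "0 \<le> \<Delta>"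
  shows "(\<Delta> * real (card {(u, v). u \<in> P \<and> v \<in> P \<and> u - v \<in> D})) ^ 6
    \<le> 2 ^ 12 * real L ^ 3 * \<sigma> * \<tau> ^ 2 * real (card U) ^ 3 * real (card D) ^ 5 * real (card P) ^ 4"
proof -
  define Z where "Z = {(u, v). u \<in> P \<and> v \<in> P \<and> u - v \<in> D}"
  define Y where "Y = diffset D U"
  have finZ: "finite Z" unfolding Z_def by (rule finite_subset[of _ "P \<times> P"]) (use fin in auto)
  have finY: "finite Y" unfolding Y_def using fin by (intro finite_diffset)
  have "\<Delta> * real (card Z) = (\<Sum>z\<in>Z. \<Delta>)" by simp
  also have "\<dots> \<le> (\<Sum>z\<in>Z. real (card {a \<in> U. fst z - a \<in> V}))"
    by (intro sum_mono pop) (auto simp: Z_def)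
  also have "\<dots> = real (card (SIGMA z:Z. {a \<in> U. fst z - a \<in> V}))"
    using finZ fin by (simp add: card_SigmaI)
  also have "\<dots> \<le> real (card (SIGMA y:Y. {a \<in> U. a + y \<in> D} \<times> {b \<in> V. b + - y \<in> P}))"
  proof (rule of_nat_mono, rule card_inj_on_le[where f = "\<lambda>((u, v), a). (u - v - a, (a, u - a))"])
    show "inj_on (\<lambda>((u, v), a). (u - v - a, (a, u - a))) (SIGMA z:Z. {a \<in> U. fst z - a \<in> V})"
      by (auto simp: inj_on_def)
    show "(\<lambda>((u, v), a). (u - v - a, (a, u - a))) ` (SIGMA z:Z. {a \<in> U. fst z - a \<in> V})
        \<subseteq> (SIGMA y:Y. {a \<in> U. a + y \<in> D} \<times> {b \<in> V. b + - y \<in> P})"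
      by (auto simp: Z_def Y_def diffset_def)
  qed (use finY fin in auto)
  also have "\<dots> = (\<Sum>y\<in>Y. real (shift_count U D y) * real (shift_count V P (- y)))"
    using finY fin by (simp add: card_SigmaI card_cartesian_product shift_count_def)
  finally have "(\<Delta> * real (card Z)) ^ 6 \<le> (\<Sum>y\<in>Y. real (shift_count U D y) * real (shift_count V P (- y))) ^ 6"
    using \<Delta> by (intro power_mono) auto
  also have "\<dots> \<le> (\<Sum>y\<in>Y. real (shift_count U D y)) ^ 3 * (\<Sum>y\<in>Y. real (shift_count U D y) ^ 3)
      * (\<Sum>y\<in>Y. real (shift_count V P (- y)) ^ 3) ^ 2"
    by (rule sum_mult_power6_le) auto
  also have "(\<Sum>y\<in>Y. real (shift_count V P (- y)) ^ 3) = (\<Sum>y\<in>uminus ` Y. real (shift_count V P y) ^ 3)"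
    by (simp add: sum.reindex)
  also have "(\<Sum>y\<in>Y. real (shift_count U D y)) ^ 3 * (\<Sum>y\<in>Y. real (shift_count U D y) ^ 3)
      * (\<Sum>y\<in>uminus ` Y. real (shift_count V P y) ^ 3) ^ 2
    \<le> (real (card U) * real (card D)) ^ 3 * (16 * real L * \<sigma> * real (card D) ^ 2) * (16 * real L * \<tau> * real (card P) ^ 2) ^ 2"
    using finY fin L rb rich_bound_nonneg[OF rb(1)]
    by (intro mult_mono power_mono sum_shift_count_le sum_shift_count_cube_le) (auto intro!: sum_nonneg mult_nonneg_nonneg)
  also have "\<dots> = 2 ^ 12 * real L ^ 3 * \<sigma> * \<tau> ^ 2 * real (card U) ^ 3 * real (card D) ^ 5 * real (card P) ^ 4"
    by (simp add: power_mult_distrib eval_nat_numeral mult_ac)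
  finally show ?thesis by (simp add: Z_def)
qed

text \<open>Each triple \<open>(a, a', b)\<close> with \<open>a + b\<close> and \<open>a' + b\<close> popular gives a solution of
  \<open>a - a' = (a + b) - (a' + b)\<close>; two triples give the same pair of popular sums exactly when
  they differ by a translation \<open>(x, x, - x)\<close>, and such coincidences are counted by the third energies.\<close>

theorem popular_difference_energy:
  assumes fin: "finite U" "finite V" and ne: "U \<noteq> {}" "V \<noteq> {}"
    and rb: "rich_bound U \<sigma>" "rich_bound V \<tau>" and L: "card U \<le> 2 ^ L" "card V \<le> 2 ^ L" "1 \<le> L"
  obtains U' where "U' \<subseteq> U" "card U \<le> 2 * card U'"
    "\<And>D. finite D \<Longrightarrow> real (card {(a, a'). a \<in> U' \<and> a' \<in> U' \<and> a - a' \<in> D}) ^ 12 * real (card V) ^ 12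
        * (real (card U) * real (card V)) ^ 6
      \<le> 2 ^ 48 * real L ^ 3 * energy 3 U ^ 4 * energy 3 V ^ 2 * \<sigma> * \<tau> ^ 2 * real (card U) ^ 3
        * real (card D) ^ 5 * real (card (sumset U V)) ^ 10"
proof -
  obtain U' P where U': "U' \<subseteq> U" "card U \<le> 2 * card U'" and P: "P \<subseteq> sumset U V"
    "\<And>s. s \<in> P \<Longrightarrow> real (card U) * real (card V) \<le> 16 * real (card (sumset U V)) * real (card {a \<in> U. s - a \<in> V})"
    and common: "\<And>a a'. a \<in> U' \<Longrightarrow> a' \<in> U' \<Longrightarrow> real (card V) \<le> 2 * real (card {b \<in> V. a + b \<in> P \<and> a' + b \<in> P})"
    using exists_popular_sums[OF fin ne] by blast
  have finS: "finite (sumset U V)" using fin by (rule finite_sumset)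
  have finP: "finite P" using P(1) finS by (rule finite_subset)
  have finU': "finite U'" using U'(1) fin(1) by (rule finite_subset)
  define u where "u = real (card U)"
  define v where "v = real (card V)"
  define s where "s = real (card (sumset U V))"
  have uv: "u > 0" "v > 0" using fin ne by (auto simp: u_def v_def card_gt_0_iff)
  obtain a0 b0 where "a0 \<in> U" "b0 \<in> V" using ne by auto
  then have "a0 + b0 \<in> sumset U V" unfolding sumset_def by blast
  then have sp: "s > 0" using finS by (auto simp: s_def card_gt_0_iff)
  have Ps: "real (card P) \<le> s" unfolding s_def using P(1) finS by (intro of_nat_mono card_mono)
  have \<sigma>\<tau>: "0 \<le> \<sigma>" "0 \<le> \<tau>" using rb rich_bound_nonneg by auto
  show thesis
  proof (rule that[OF U'])
    fix D :: "real set" assume D: "finite D"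
    define W where "W = {(a, a'). a \<in> U' \<and> a' \<in> U' \<and> a - a' \<in> D}"
    define w where "w = real (card W)"
    define Z where "Z = {(u, v). u \<in> P \<and> v \<in> P \<and> u - v \<in> D}"
    define Tr where "Tr = (SIGMA aa:W. {b \<in> V. fst aa + b \<in> P \<and> snd aa + b \<in> P})"
    define \<phi> where "\<phi> = (\<lambda>((a::real, a'::real), b::real). (a + b, a' + b))"
    \<comment> \<open>The shift x moves both U-entries of a triple forward and its V-entry backward,
      hence two factors for U and one for V. Hoelder bounds Q^3 by
      \<open>energy 3 U ^ 2 * energy 3 V\<close>.\<close>
    define Q where "Q = (\<Sum>x\<in>diffset U U. real (shift_count U U x) ^ 2 * real (shift_count V V x))"
    have finW: "finite W" unfolding W_def by (rule finite_subset[of _ "U' \<times> U'"]) (use finU' in auto)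
    have finZ: "finite Z" unfolding Z_def by (rule finite_subset[of _ "P \<times> P"]) (use finP in auto)
    have finTr: "finite Tr" unfolding Tr_def using finW fin by auto
    have "w * v = (\<Sum>aa\<in>W. v)" by (simp add: w_def)
    also have "\<dots> \<le> (\<Sum>aa\<in>W. 2 * real (card {b \<in> V. fst aa + b \<in> P \<and> snd aa + b \<in> P}))"
      unfolding v_def by (intro sum_mono common) (auto simp: W_def)
    also have "\<dots> = 2 * real (card Tr)"
      unfolding Tr_def using finW fin by (simp add: card_SigmaI sum_distrib_left)
    finally have Tr: "w * v \<le> 2 * real (card Tr)" .
    have "real (card Tr) ^ 2 \<le> real (card Z) * real (card {(t, t'). t \<in> Tr \<and> t' \<in> Tr \<and> \<phi> t = \<phi> t'})"
      by (rule card_squared_le_fibres[OF finTr finZ]) (auto simp: Tr_def Z_def W_def \<phi>_def)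
    also have "\<dots> \<le> real (card Z) * Q"
    proof (rule mult_left_mono)
      let ?K = "SIGMA x:diffset U U. ({a \<in> U. a + x \<in> U} \<times> {a \<in> U. a + x \<in> U}) \<times> {b \<in> V. b + x \<in> V}"
      have "card {(t, t'). t \<in> Tr \<and> t' \<in> Tr \<and> \<phi> t = \<phi> t'} \<le> card ?K"
      proof (rule card_inj_on_le[where f = "\<lambda>(((a, a'), b), ((c, c'), d)). (c - a, ((a, a'), d))"])
        show "inj_on (\<lambda>(((a, a'), b), ((c, c'), d)). (c - a, ((a, a'), d)))
            {(t, t'). t \<in> Tr \<and> t' \<in> Tr \<and> \<phi> t = \<phi> t'}"
          by (auto simp: inj_on_def \<phi>_def)
        show "(\<lambda>(((a, a'), b), ((c, c'), d)). (c - a, ((a, a'), d))) ` {(t, t'). t \<in> Tr \<and> t' \<in> Tr \<and> \<phi> t = \<phi> t'} \<subseteq> ?K"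
        proof (rule image_subsetI)
          fix z assume z: "z \<in> {(t, t'). t \<in> Tr \<and> t' \<in> Tr \<and> \<phi> t = \<phi> t'}"
          obtain a a' b c c' d where zz: "z = (((a, a'), b), ((c, c'), d))"
            by (metis surj_pair)
          have e: "a + b = c + d" "a' + b = c' + d" using z by (auto simp: zz \<phi>_def)
          have m: "a \<in> U" "a' \<in> U" "c \<in> U" "c' \<in> U" "b \<in> V" "d \<in> V"
            using z U'(1) by (auto simp: zz Tr_def W_def)
          have "a + (c - a) = c" "a' + (c - a) = c'" "d + (c - a) = b" using e by auto
          then show "(\<lambda>(((a, a'), b), ((c, c'), d)). (c - a, ((a, a'), d))) z \<in> ?K"
            using m by (auto simp: zz diffset_def)
        qed
        show "finite ?K" using fin by (auto intro!: finite_diffset)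
      qed
      then have "real (card {(t, t'). t \<in> Tr \<and> t' \<in> Tr \<and> \<phi> t = \<phi> t'}) \<le> real (card ?K)" by (rule of_nat_mono)
      also have "\<dots> = Q"
        using fin finite_diffset[OF fin(1) fin(1)]
        by (simp add: Q_def card_SigmaI card_cartesian_product shift_count_def power2_eq_square)
      finally show "real (card {(t, t'). t \<in> Tr \<and> t' \<in> Tr \<and> \<phi> t = \<phi> t'}) \<le> Q" .
    qed simp
    finally have Tr2: "real (card Tr) ^ 2 \<le> real (card Z) * Q" .
    have Q0: "0 \<le> Q" unfolding Q_def by (intro sum_nonneg) auto
    have "Q ^ 3 \<le> (\<Sum>x\<in>diffset U U. real (shift_count U U x) ^ 3) ^ 2 * (\<Sum>x\<in>diffset U U. real (shift_count V V x) ^ 3)"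
      unfolding Q_def by (rule sum_square_mult_power3_le) auto
    also have "\<dots> \<le> energy 3 U ^ 2 * energy 3 V"
      using fin finite_diffset[OF fin(1) fin(1)]
      by (intro mult_mono power_mono sum_le_energy) (auto intro!: sum_nonneg energy_nonneg)
    finally have "(Q ^ 3) ^ 2 \<le> (energy 3 U ^ 2 * energy 3 V) ^ 2" using Q0 by (intro power_mono) auto
    then have Q6: "Q ^ 6 \<le> energy 3 U ^ 4 * energy 3 V ^ 2" by (simp add: power_mult_distrib flip: power_mult)
    \<comment> \<open>The popularity threshold of P. Its sixth power contributes s^6, which joins
      the s^4 from |P|^4 to give the power 10 of the sumset.\<close>
    define \<Delta> where "\<Delta> = u * v / (16 * s)"
    have \<Delta>0: "\<Delta> > 0" using uv sp by (simp add: \<Delta>_def)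
    have "(\<Delta> * real (card Z)) ^ 6
      \<le> 2 ^ 12 * real L ^ 3 * \<sigma> * \<tau> ^ 2 * u ^ 3 * real (card D) ^ 5 * real (card P) ^ 4"
      unfolding Z_def u_def
    proof (rule card_popular_differences_le[OF fin D finP rb L])
      fix w assume "w \<in> P"
      then show "\<Delta> \<le> real (card {a \<in> U. w - a \<in> V})"
        using P(2)[of w] sp unfolding \<Delta>_def u_def[symmetric] v_def[symmetric] s_def[symmetric]
        by (simp add: field_simps)
    qed (use \<Delta>0 in simp)
    also have "\<dots> \<le> 2 ^ 12 * real L ^ 3 * \<sigma> * \<tau> ^ 2 * u ^ 3 * real (card D) ^ 5 * s ^ 4"
      using Ps \<sigma>\<tau> uv by (intro mult_left_mono power_mono) auto
    finally have Z6: "(\<Delta> * real (card Z)) ^ 6 \<le> 2 ^ 12 * real L ^ 3 * \<sigma> * \<tau> ^ 2 * u ^ 3 * real (card D) ^ 5 * s ^ 4" .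
    have "(w * v) ^ 2 \<le> (2 * real (card Tr)) ^ 2" using Tr uv by (intro power_mono) (auto simp: w_def)
    also have "\<dots> \<le> 4 * (real (card Z) * Q)" using Tr2 by (simp add: power_mult_distrib)
    finally have "\<Delta> * (w * v) ^ 2 \<le> \<Delta> * (4 * (real (card Z) * Q))" using \<Delta>0 by (intro mult_left_mono) auto
    then have "(\<Delta> * (w * v) ^ 2) ^ 6 \<le> (\<Delta> * (4 * (real (card Z) * Q))) ^ 6"
      using \<Delta>0 by (intro power_mono) auto
    also have "\<dots> = 4 ^ 6 * ((\<Delta> * real (card Z)) ^ 6 * Q ^ 6)" by (simp add: power_mult_distrib)
    also have "\<dots> \<le> 4 ^ 6 * ((2 ^ 12 * real L ^ 3 * \<sigma> * \<tau> ^ 2 * u ^ 3 * real (card D) ^ 5 * s ^ 4) * (energy 3 U ^ 4 * energy 3 V ^ 2))"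
      by (intro mult_left_mono mult_mono Z6 Q6) (use \<sigma>\<tau> uv sp Q0 in auto)
    finally have fin1: "(\<Delta> * (w * v) ^ 2) ^ 6
      \<le> 4 ^ 6 * ((2 ^ 12 * real L ^ 3 * \<sigma> * \<tau> ^ 2 * u ^ 3 * real (card D) ^ 5 * s ^ 4) * (energy 3 U ^ 4 * energy 3 V ^ 2))" .
    have "(\<Delta> * (w * v) ^ 2) ^ 6 = w ^ 12 * v ^ 12 * (u * v) ^ 6 / (2 ^ 24 * s ^ 6)"
      by (simp add: \<Delta>_def power_mult_distrib power_divide flip: power_mult)
    then have "w ^ 12 * v ^ 12 * (u * v) ^ 6 = (\<Delta> * (w * v) ^ 2) ^ 6 * (2 ^ 24 * s ^ 6)"
      using sp by simp
    also have "\<dots> \<le> 4 ^ 6 * ((2 ^ 12 * real L ^ 3 * \<sigma> * \<tau> ^ 2 * u ^ 3 * real (card D) ^ 5 * s ^ 4) * (energy 3 U ^ 4 * energy 3 V ^ 2)) * (2 ^ 24 * s ^ 6)"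
      using fin1 sp by (intro mult_right_mono) auto
    also have "\<dots> = 2 ^ 48 * real L ^ 3 * energy 3 U ^ 4 * energy 3 V ^ 2 * \<sigma> * \<tau> ^ 2 * u ^ 3 * real (card D) ^ 5 * s ^ 10"
      by (simp add: mult_ac flip: power_add)
    finally show "real (card {(a, a'). a \<in> U' \<and> a' \<in> U' \<and> a - a' \<in> D}) ^ 12 * real (card V) ^ 12
        * (real (card U) * real (card V)) ^ 6
      \<le> 2 ^ 48 * real L ^ 3 * energy 3 U ^ 4 * energy 3 V ^ 2 * \<sigma> * \<tau> ^ 2 * real (card U) ^ 3
        * real (card D) ^ 5 * real (card (sumset U V)) ^ 10"
      by (simp add: w_def W_def u_def v_def s_def)
  qed
qed

section \<open>Lower bounds for sumsets and difference sets\<close>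

text \<open>The level set D, at height t, that carries the second energy. The first-moment
  inequality makes D fit for \<open>popular_difference_energy\<close>; the third-moment one is used
  afterwards to eliminate t.\<close>

lemma exists_energy2_level:
  assumes "finite U" "U \<noteq> {}" "card U \<le> 2 ^ L" "1 \<le> L"
  obtains D and t :: real where "finite D" "D \<noteq> {}" "0 < t"
    "real (card D) * t \<le> real (card {(a, a'). a \<in> U \<and> a' \<in> U \<and> a - a' \<in> D})"
    "real (card D) * t ^ 3 \<le> energy 3 U" "energy 2 U \<le> 8 * real L * (real (card D) * t ^ 2)"
proof -
  define D where "D = (\<lambda>k. {x \<in> diffset U U. 2 ^ k \<le> shift_count U U x \<and> shift_count U U x < 2 ^ (k + 1)})"
  have finD: "finite (D k)" for k unfolding D_def using finite_diffset[OF assms(1,1)] by auto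
  have "energy 2 U \<le> (\<Sum>k\<le>L. 2 ^ 2 * (2 ^ k) ^ 2 * real (card (D k)))"
    unfolding energy_def D_def using finite_diffset[OF assms(1,1)]
    by (intro sum_power_le_dyadic order_trans[OF shift_count_le[OF assms(1)] assms(3)]) auto
  then obtain k where k: "energy 2 U \<le> real (L + 1) * (2 ^ 2 * (2 ^ k) ^ 2 * real (card (D k)))"
    by (rule sum_atMost_pigeonhole)
  define t where "t = (2::real) ^ k"
  have t: "t > 0" by (simp add: t_def)
  have "energy 2 U \<ge> 1" by (rule energy_pos[OF assms(1,2)])
  then have "card (D k) \<noteq> 0" using k by (intro notI) simp
  then have ne: "D k \<noteq> {}" by auto
  have lvl: "t \<le> real (shift_count U U x)" if "x \<in> D k" for x
  proof -
    have "real (2 ^ k) \<le> real (shift_count U U x)" using that unfolding D_def by (intro of_nat_mono) simp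
    then show ?thesis by (simp add: t_def)
  qed
  have e2: "energy 2 U \<le> 8 * real L * (real (card (D k)) * t ^ 2)"
  proof -
    have "energy 2 U \<le> real (L + 1) * (4 * t ^ 2 * real (card (D k)))" using k by (simp add: t_def)
    also have "\<dots> \<le> (2 * real L) * (4 * t ^ 2 * real (card (D k)))"
      using assms(4) by (intro mult_right_mono) auto
    finally show ?thesis by (simp add: mult_ac)
  qed
  have "real (card (D k)) * t = (\<Sum>x\<in>D k. t)" by simp
  also have "\<dots> \<le> (\<Sum>x\<in>D k. real (shift_count U U x))" by (intro sum_mono lvl)
  also have "\<dots> = real (card (SIGMA x:D k. {u \<in> U. u + x \<in> U}))"
    using assms(1) finD by (simp add: card_SigmaI shift_count_def)
  also have "\<dots> \<le> real (card {(a, a'). a \<in> U \<and> a' \<in> U \<and> a - a' \<in> D k})"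
  proof (rule of_nat_mono, rule card_inj_on_le[where f = "\<lambda>(x, u). (u + x, u)"])
    show "finite {(a, a'). a \<in> U \<and> a' \<in> U \<and> a - a' \<in> D k}"
      by (rule finite_subset[of _ "U \<times> U"]) (use assms in auto)
  qed (auto simp: inj_on_def)
  finally have W: "real (card (D k)) * t \<le> real (card {(a, a'). a \<in> U \<and> a' \<in> U \<and> a - a' \<in> D k})" .
  have "real (card (D k)) * t ^ 3 = (\<Sum>x\<in>D k. t ^ 3)" by simp
  also have "\<dots> \<le> (\<Sum>x\<in>D k. real (shift_count U U x) ^ 3)" using t by (intro sum_mono power_mono lvl) auto
  also have "\<dots> \<le> energy 3 U" by (intro sum_le_energy assms finD) simp
  finally show thesis using that[OF finD ne t W _ e2] by blast
qed

text \<open>Cauchy-Schwarz twice: over the fibres of addition, and then over x after sorting the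
  coincidences a + b = c + d by x = c - a = b - d.\<close>

lemma energy2_sumset:
  assumes "finite U" "finite V"
  shows "(real (card U) * real (card V)) ^ 4 \<le> real (card (sumset U V)) ^ 2 * (energy 2 U * energy 2 V)"
proof -
  define Q where "Q = (\<Sum>x\<in>diffset U U. real (shift_count U U x) * real (shift_count V V x))"
  let ?K = "SIGMA x:diffset U U. {a \<in> U. a + x \<in> U} \<times> {b \<in> V. b + x \<in> V}"
  let ?\<phi> = "\<lambda>(a::real, b::real). a + b"
  have finD: "finite (diffset U U)" using assms by (intro finite_diffset)
  have "(real (card U) * real (card V)) ^ 2 = real (card (U \<times> V)) ^ 2" by (simp add: card_cartesian_product)
  also have "\<dots> \<le> real (card (sumset U V)) * real (card {(s, s'). s \<in> U \<times> V \<and> s' \<in> U \<times> V \<and> ?\<phi> s = ?\<phi> s'})"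
    using assms by (intro card_squared_le_fibres finite_sumset) (auto simp: sumset_def)
  also have "\<dots> \<le> real (card (sumset U V)) * Q"
  proof (rule mult_left_mono)
    have "card {(s, s'). s \<in> U \<times> V \<and> s' \<in> U \<times> V \<and> ?\<phi> s = ?\<phi> s'} \<le> card ?K"
    proof (rule card_inj_on_le[where f = "\<lambda>((a, b), (c, d)). (c - a, (a, d))"])
      show "(\<lambda>((a, b), (c, d)). (c - a, (a, d))) ` {(s, s'). s \<in> U \<times> V \<and> s' \<in> U \<times> V \<and> ?\<phi> s = ?\<phi> s'} \<subseteq> ?K"
      proof (rule image_subsetI)
        fix z assume z: "z \<in> {(s, s'). s \<in> U \<times> V \<and> s' \<in> U \<times> V \<and> ?\<phi> s = ?\<phi> s'}"
        obtain a b c d where zz: "z = ((a, b), (c, d))" by (metis surj_pair)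
        have e: "a + b = c + d" and m: "a \<in> U" "c \<in> U" "b \<in> V" "d \<in> V" using z by (auto simp: zz)
        have "a + (c - a) = c" "d + (c - a) = b" using e by auto
        then show "(\<lambda>((a, b), (c, d)). (c - a, (a, d))) z \<in> ?K" using m by (auto simp: zz diffset_def)
      qed
    qed (use assms finD in \<open>auto simp: inj_on_def\<close>)
    then have "real (card {(s, s'). s \<in> U \<times> V \<and> s' \<in> U \<times> V \<and> ?\<phi> s = ?\<phi> s'}) \<le> real (card ?K)" by (rule of_nat_mono)
    also have "\<dots> = Q" using assms finD by (simp add: Q_def card_SigmaI card_cartesian_product shift_count_def)
    finally show "real (card {(s, s'). s \<in> U \<times> V \<and> s' \<in> U \<times> V \<and> ?\<phi> s = ?\<phi> s'}) \<le> Q" .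
  qed simp
  finally have "((real (card U) * real (card V)) ^ 2) ^ 2 \<le> (real (card (sumset U V)) * Q) ^ 2"
    by (intro power_mono) auto
  also have "\<dots> = real (card (sumset U V)) ^ 2 * Q ^ 2" by (simp add: power_mult_distrib)
  also have "Q ^ 2 \<le> (\<Sum>x\<in>diffset U U. real (shift_count U U x) ^ 2) * (\<Sum>x\<in>diffset U U. real (shift_count V V x) ^ 2)"
    unfolding Q_def by (rule Cauchy_Schwarz_ineq_sum)
  also have "\<dots> \<le> energy 2 U * energy 2 V"
    using assms finD by (intro mult_mono sum_le_energy) (auto intro!: sum_nonneg energy_nonneg)
  finally show ?thesis by (simp add: mult_left_mono flip: power_mult)
qed

text \<open>The level set of size d and height t turns \<open>popular_difference_energy\<close> into
  a bound for d^7 t^12. Together with d t^3 \<le> E, where E is the third energy, the combination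
  yielding a power of d t^2 is (d t^2)^9 = (d^7 t^12) (d t^3)^2; hence the ninth power and two more
  factors \<open>energy 3 U\<close>.\<close>

lemma energy2_bound:
  assumes fin: "finite U" "finite V" and ne: "U \<noteq> {}" "V \<noteq> {}"
    and rb: "rich_bound U \<sigma>" "rich_bound V \<tau>" and L: "card U \<le> 2 ^ L" "card V \<le> 2 ^ L" "1 \<le> L"
  obtains U' where "U' \<subseteq> U" "card U \<le> 2 * card U'"
    "energy 2 U' ^ 9 * real (card V) ^ 12 * (real (card U) * real (card V)) ^ 6
      \<le> 2 ^ 75 * real L ^ 12 * energy 3 U ^ 6 * energy 3 V ^ 2 * \<sigma> * \<tau> ^ 2 * real (card U) ^ 3
        * real (card (sumset U V)) ^ 10"
proof -
  obtain U' where U': "U' \<subseteq> U" "card U \<le> 2 * card U'"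
    and main: "\<And>D. finite D \<Longrightarrow> real (card {(a, a'). a \<in> U' \<and> a' \<in> U' \<and> a - a' \<in> D}) ^ 12 * real (card V) ^ 12
        * (real (card U) * real (card V)) ^ 6
      \<le> 2 ^ 48 * real L ^ 3 * energy 3 U ^ 4 * energy 3 V ^ 2 * \<sigma> * \<tau> ^ 2 * real (card U) ^ 3
        * real (card D) ^ 5 * real (card (sumset U V)) ^ 10"
    using popular_difference_energy[OF assms] by blast
  have finU': "finite U'" using U'(1) fin(1) by (rule finite_subset)
  have "card U > 0" using fin ne by (simp add: card_gt_0_iff)
  then have U'ne: "U' \<noteq> {}" using U'(2) by auto
  have U'L: "card U' \<le> 2 ^ L" using card_mono[OF fin(1) U'(1)] L(1) by linarith
  obtain D and t :: real where D: "finite D" "D \<noteq> {}" "0 < t"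
    "real (card D) * t \<le> real (card {(a, a'). a \<in> U' \<and> a' \<in> U' \<and> a - a' \<in> D})"
    "real (card D) * t ^ 3 \<le> energy 3 U'" "energy 2 U' \<le> 8 * real L * (real (card D) * t ^ 2)"
    by (rule exists_energy2_level[OF finU' U'ne U'L L(3)])
  define d where "d = real (card D)"
  define l where "l = real L"
  define e where "e = energy 3 U"
  define N where "N = real (card V) ^ 12 * (real (card U) * real (card V)) ^ 6"
  define K where "K = 2 ^ 48 * l ^ 3 * e ^ 4 * energy 3 V ^ 2 * \<sigma> * \<tau> ^ 2 * real (card U) ^ 3
        * real (card (sumset U V)) ^ 10"
  have dp: "d > 0" using D by (simp add: d_def card_gt_0_iff)
  have lp: "l \<ge> 0" by (simp add: l_def)
  have N0: "N \<ge> 0" by (simp add: N_def)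
  have e0: "e \<ge> 0" by (simp add: e_def energy_nonneg)
  have "(d * t) ^ 12 * N \<le> real (card {(a, a'). a \<in> U' \<and> a' \<in> U' \<and> a - a' \<in> D}) ^ 12 * N"
    using D(3,4) N0 dp by (intro mult_right_mono power_mono) (auto simp: d_def)
  also have "\<dots> \<le> K * d ^ 5"
    using main[OF D(1)] by (simp add: N_def K_def d_def l_def e_def mult_ac)
  finally have "(d ^ 7 * t ^ 12 * N) * d ^ 5 \<le> K * d ^ 5"
    by (simp add: power_mult_distrib mult_ac flip: power_add)
  then have 1: "d ^ 7 * t ^ 12 * N \<le> K" using dp by (simp add: mult_le_cancel_right)
  have de: "d * t ^ 3 \<le> e"
    using D(5) energy_mono[OF fin(1) U'(1), of 3] by (simp add: d_def e_def)
  have "energy 2 U' ^ 9 \<le> (8 * l * (d * t ^ 2)) ^ 9"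
    using D(6) by (intro power_mono) (auto simp: d_def l_def energy_nonneg)
  also have "\<dots> = 2 ^ 27 * l ^ 9 * (d ^ 7 * t ^ 12) * (d * t ^ 3) ^ 2"
    by (simp add: power_mult_distrib mult_ac flip: power_mult power_add)
  also have "\<dots> \<le> 2 ^ 27 * l ^ 9 * (d ^ 7 * t ^ 12) * e ^ 2"
    using de dp lp D(3) by (intro mult_left_mono power_mono) auto
  finally have "energy 2 U' ^ 9 * N \<le> 2 ^ 27 * l ^ 9 * (d ^ 7 * t ^ 12) * e ^ 2 * N"
    using N0 by (intro mult_right_mono)
  also have "\<dots> = 2 ^ 27 * l ^ 9 * e ^ 2 * (d ^ 7 * t ^ 12 * N)" by simp
  also have "\<dots> \<le> 2 ^ 27 * l ^ 9 * e ^ 2 * K" using 1 lp by (intro mult_left_mono) auto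
  also have "\<dots> = 2 ^ 75 * l ^ 12 * e ^ 6 * energy 3 V ^ 2 * \<sigma> * \<tau> ^ 2 * real (card U) ^ 3
        * real (card (sumset U V)) ^ 10"
    by (simp add: K_def mult_ac flip: power_add)
  finally show thesis using that[OF U'] by (simp add: N_def l_def e_def mult.assoc)
qed

text \<open>\<open>energy2_bound\<close> for (U, V) and for (V, U), multiplied to restore symmetry,
  is inserted into the ninth power of \<open>energy2_sumset\<close>. The sumset thus gets 18 + 10 +
  10 = 38 and |U||V| gets 36 + 24 - 3 = 57.\<close>

theorem sumset_energy_bound:
  assumes fin: "finite U" "finite V" and ne: "U \<noteq> {}" "V \<noteq> {}"
    and rb: "rich_bound U \<sigma>" "rich_bound V \<tau>" and L: "card U \<le> 2 ^ L" "card V \<le> 2 ^ L" "1 \<le> L"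
  shows "(real (card U) * real (card V)) ^ 57
    \<le> 2 ^ 222 * real L ^ 24 * (energy 3 U * energy 3 V) ^ 8 * (\<sigma> * \<tau>) ^ 3 * real (card (sumset U V)) ^ 38"
proof -
  define u where "u = real (card U)"
  define v where "v = real (card V)"
  define s where "s = real (card (sumset U V))"
  define l where "l = real L"
  define a where "a = energy 3 U"
  define b where "b = energy 3 V"
  have uv: "u > 0" "v > 0" using fin ne by (auto simp: u_def v_def card_gt_0_iff)
  have nn: "0 \<le> a" "0 \<le> b" "0 \<le> \<sigma>" "0 \<le> \<tau>" "0 \<le> s" "0 \<le> l"
    using rb rich_bound_nonneg energy_nonneg by (auto simp: a_def b_def s_def l_def)
  obtain U' where U': "U' \<subseteq> U" "card U \<le> 2 * card U'"
    and 1: "energy 2 U' ^ 9 * v ^ 12 * (u * v) ^ 6 \<le> 2 ^ 75 * l ^ 12 * a ^ 6 * b ^ 2 * \<sigma> * \<tau> ^ 2 * u ^ 3 * s ^ 10"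
    unfolding a_def b_def u_def v_def s_def l_def by (rule energy2_bound[OF assms])
  obtain V' where V': "V' \<subseteq> V" "card V \<le> 2 * card V'"
    and 2: "energy 2 V' ^ 9 * u ^ 12 * (v * u) ^ 6 \<le> 2 ^ 75 * l ^ 12 * b ^ 6 * a ^ 2 * \<tau> * \<sigma> ^ 2 * v ^ 3 * s ^ 10"
    unfolding a_def b_def u_def v_def s_def l_def sumset_commute[of U V]
    by (rule energy2_bound[OF fin(2,1) ne(2,1) rb(2,1) L(2,1,3)])
  have fin': "finite U'" "finite V'" using U' V' fin finite_subset by blast+
  define x where "x = energy 2 U'"
  define y where "y = energy 2 V'"
  have xy: "0 \<le> x" "0 \<le> y" by (auto simp: x_def y_def energy_nonneg)
  have "u \<le> 2 * real (card U')" "v \<le> 2 * real (card V')" using U'(2) V'(2) unfolding u_def v_def by linarith+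
  then have "u * v \<le> (2 * real (card U')) * (2 * real (card V'))" using uv by (intro mult_mono) auto
  then have "(u * v) ^ 4 \<le> (4 * (real (card U') * real (card V'))) ^ 4" using uv by (intro power_mono) auto
  also have "\<dots> = 2 ^ 8 * (real (card U') * real (card V')) ^ 4" by (simp add: power_mult_distrib)
  also have "\<dots> \<le> 2 ^ 8 * (real (card (sumset U' V')) ^ 2 * (x * y))"
    unfolding x_def y_def by (intro mult_left_mono energy2_sumset fin') auto
  also have "\<dots> \<le> 2 ^ 8 * (s ^ 2 * (x * y))"
    unfolding s_def using xy U' V' fin
    by (intro mult_left_mono mult_right_mono power_mono of_nat_mono card_mono finite_sumset sumset_mono) auto
  finally have "((u * v) ^ 4) ^ 9 \<le> (2 ^ 8 * (s ^ 2 * (x * y))) ^ 9" using uv by (intro power_mono) auto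
  then have 3: "(u * v) ^ 36 \<le> 2 ^ 72 * s ^ 18 * (x ^ 9 * y ^ 9)"
    by (simp add: power_mult_distrib mult_ac flip: power_mult)
  have "(x ^ 9 * v ^ 12 * (u * v) ^ 6) * (y ^ 9 * u ^ 12 * (v * u) ^ 6)
    \<le> (2 ^ 75 * l ^ 12 * a ^ 6 * b ^ 2 * \<sigma> * \<tau> ^ 2 * u ^ 3 * s ^ 10) * (2 ^ 75 * l ^ 12 * b ^ 6 * a ^ 2 * \<tau> * \<sigma> ^ 2 * v ^ 3 * s ^ 10)"
    by (rule mult_mono[OF 1[folded x_def] 2[folded y_def]]) (use nn uv xy in auto)
  also have "(x ^ 9 * v ^ 12 * (u * v) ^ 6) * (y ^ 9 * u ^ 12 * (v * u) ^ 6) = x ^ 9 * y ^ 9 * (u * v) ^ 24"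
    by (simp add: power_mult_distrib mult_ac flip: power_add)
  also have "(2 ^ 75 * l ^ 12 * a ^ 6 * b ^ 2 * \<sigma> * \<tau> ^ 2 * u ^ 3 * s ^ 10) * (2 ^ 75 * l ^ 12 * b ^ 6 * a ^ 2 * \<tau> * \<sigma> ^ 2 * v ^ 3 * s ^ 10)
    = 2 ^ 150 * l ^ 24 * (a * b) ^ 8 * (\<sigma> * \<tau>) ^ 3 * s ^ 20 * (u * v) ^ 3"
    by algebra
  finally have 4: "x ^ 9 * y ^ 9 * (u * v) ^ 24 \<le> 2 ^ 150 * l ^ 24 * (a * b) ^ 8 * (\<sigma> * \<tau>) ^ 3 * s ^ 20 * (u * v) ^ 3" .
  have "(u * v) ^ 57 * (u * v) ^ 3 = (u * v) ^ 36 * (u * v) ^ 24" by (simp flip: power_add)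
  also have "\<dots> \<le> 2 ^ 72 * s ^ 18 * (x ^ 9 * y ^ 9) * (u * v) ^ 24"
    using 3 uv by (intro mult_right_mono) auto
  also have "\<dots> = 2 ^ 72 * s ^ 18 * (x ^ 9 * y ^ 9 * (u * v) ^ 24)" by simp
  also have "\<dots> \<le> 2 ^ 72 * s ^ 18 * (2 ^ 150 * l ^ 24 * (a * b) ^ 8 * (\<sigma> * \<tau>) ^ 3 * s ^ 20 * (u * v) ^ 3)"
    using 4 nn by (intro mult_left_mono) auto
  also have "\<dots> = (2 ^ 222 * l ^ 24 * (a * b) ^ 8 * (\<sigma> * \<tau>) ^ 3 * s ^ 38) * (u * v) ^ 3"
    by (simp add: mult_ac flip: power_add)
  finally have "(u * v) ^ 57 \<le> 2 ^ 222 * l ^ 24 * (a * b) ^ 8 * (\<sigma> * \<tau>) ^ 3 * s ^ 38"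
    using uv by (subst (asm) mult_le_cancel_right_pos) auto
  then show ?thesis by (simp add: u_def v_def s_def l_def a_def b_def)
qed

section \<open>Lower bounds involving difference sets\<close>

text \<open>With D the full difference set every pair from U' counts, so the detour through the
  second energy is avoided; the price is the explicit factor |U - U|^5.\<close>

lemma diffset_energy_bound_left:
  assumes fin: "finite U" "finite V" and ne: "U \<noteq> {}" "V \<noteq> {}"
    and rb: "rich_bound U \<sigma>" "rich_bound V \<tau>" and L: "card U \<le> 2 ^ L" "card V \<le> 2 ^ L" "1 \<le> L"
  shows "real (card U) ^ 24 * real (card V) ^ 12 * (real (card U) * real (card V)) ^ 6
    \<le> 2 ^ 72 * real L ^ 3 * energy 3 U ^ 4 * energy 3 V ^ 2 * \<sigma> * \<tau> ^ 2 * real (card U) ^ 3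
        * real (card (diffset U U)) ^ 5 * real (card (sumset U V)) ^ 10"
proof -
  obtain U' where U': "U' \<subseteq> U" "card U \<le> 2 * card U'"
    and main: "\<And>D. finite D \<Longrightarrow> real (card {(a, a'). a \<in> U' \<and> a' \<in> U' \<and> a - a' \<in> D}) ^ 12 * real (card V) ^ 12
        * (real (card U) * real (card V)) ^ 6
      \<le> 2 ^ 48 * real L ^ 3 * energy 3 U ^ 4 * energy 3 V ^ 2 * \<sigma> * \<tau> ^ 2 * real (card U) ^ 3
        * real (card D) ^ 5 * real (card (sumset U V)) ^ 10"
    using popular_difference_energy[OF assms] by blast
  define w where "w = real (card U')"
  define N where "N = real (card V) ^ 12 * (real (card U) * real (card V)) ^ 6"
  define K where "K = real L ^ 3 * energy 3 U ^ 4 * energy 3 V ^ 2 * \<sigma> * \<tau> ^ 2 * real (card U) ^ 3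
        * real (card (diffset U U)) ^ 5 * real (card (sumset U V)) ^ 10"
  have "{(a, a'). a \<in> U' \<and> a' \<in> U' \<and> a - a' \<in> diffset U U} = U' \<times> U'"
    using U'(1) by (auto simp: diffset_def)
  then have "card {(a, a'). a \<in> U' \<and> a' \<in> U' \<and> a - a' \<in> diffset U U} = card U' * card U'"
    by (simp add: card_cartesian_product)
  then have 1: "(w * w) ^ 12 * N \<le> 2 ^ 48 * K"
    using main[OF finite_diffset[OF fin(1,1)]] by (simp add: w_def N_def K_def mult.assoc)
  have "real (card U) \<le> 2 * w" using U'(2) unfolding w_def by linarith
  then have "real (card U) ^ 24 \<le> (2 * w) ^ 24" by (intro power_mono) auto
  also have "\<dots> = 2 ^ 24 * (w * w) ^ 12" by (simp add: power_mult_distrib flip: power_add)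
  finally have "real (card U) ^ 24 * N \<le> 2 ^ 24 * (w * w) ^ 12 * N" by (intro mult_right_mono) (auto simp: N_def)
  also have "\<dots> = 2 ^ 24 * ((w * w) ^ 12 * N)" by simp
  also have "\<dots> \<le> 2 ^ 24 * (2 ^ 48 * K)" by (rule mult_left_mono[OF 1]) simp
  also have "\<dots> = 2 ^ 72 * K" by simp
  finally show ?thesis by (simp add: N_def K_def mult.assoc)
qed

theorem diffset_energy_bound:
  assumes fin: "finite U" "finite V" and ne: "U \<noteq> {}" "V \<noteq> {}"
    and rb: "rich_bound U \<sigma>" "rich_bound V \<tau>" and L: "card U \<le> 2 ^ L" "card V \<le> 2 ^ L" "1 \<le> L"
  shows "(real (card U) * real (card V)) ^ 45
    \<le> 2 ^ 144 * real L ^ 6 * (energy 3 U * energy 3 V) ^ 6 * (\<sigma> * \<tau>) ^ 3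
      * (real (card (diffset U U)) * real (card (diffset V V))) ^ 5 * real (card (sumset U V)) ^ 20"
proof -
  define u where "u = real (card U)"
  define v where "v = real (card V)"
  define s where "s = real (card (sumset U V))"
  define l where "l = real L"
  define a where "a = energy 3 U"
  define b where "b = energy 3 V"
  define p where "p = real (card (diffset U U))"
  define q where "q = real (card (diffset V V))"
  have uv: "u > 0" "v > 0" using fin ne by (auto simp: u_def v_def card_gt_0_iff)
  have nn: "0 \<le> a" "0 \<le> b" "0 \<le> \<sigma>" "0 \<le> \<tau>" "0 \<le> s" "0 \<le> l" "0 \<le> p" "0 \<le> q"
    using rb rich_bound_nonneg energy_nonneg by (auto simp: a_def b_def s_def l_def p_def q_def)
  have 1: "u ^ 24 * v ^ 12 * (u * v) ^ 6 \<le> 2 ^ 72 * l ^ 3 * a ^ 4 * b ^ 2 * \<sigma> * \<tau> ^ 2 * u ^ 3 * p ^ 5 * s ^ 10"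
    unfolding a_def b_def u_def v_def s_def l_def p_def by (rule diffset_energy_bound_left[OF assms])
  have 2: "v ^ 24 * u ^ 12 * (v * u) ^ 6 \<le> 2 ^ 72 * l ^ 3 * b ^ 4 * a ^ 2 * \<tau> * \<sigma> ^ 2 * v ^ 3 * q ^ 5 * s ^ 10"
    unfolding a_def b_def u_def v_def s_def l_def q_def sumset_commute[of U V]
    by (rule diffset_energy_bound_left[OF fin(2,1) ne(2,1) rb(2,1) L(2,1,3)])
  have "(u * v) ^ 45 * (u * v) ^ 3 = (u ^ 24 * v ^ 12 * (u * v) ^ 6) * (v ^ 24 * u ^ 12 * (v * u) ^ 6)"
    by (simp add: power_mult_distrib mult_ac flip: power_add)
  also have "\<dots> \<le> (2 ^ 72 * l ^ 3 * a ^ 4 * b ^ 2 * \<sigma> * \<tau> ^ 2 * u ^ 3 * p ^ 5 * s ^ 10)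
      * (2 ^ 72 * l ^ 3 * b ^ 4 * a ^ 2 * \<tau> * \<sigma> ^ 2 * v ^ 3 * q ^ 5 * s ^ 10)"
    by (rule mult_mono[OF 1 2]) (use nn uv in auto)
  also have "\<dots> = (2 ^ 144 * l ^ 6 * (a * b) ^ 6 * (\<sigma> * \<tau>) ^ 3 * (p * q) ^ 5 * s ^ 20) * (u * v) ^ 3"
    by algebra
  finally have "(u * v) ^ 45 \<le> 2 ^ 144 * l ^ 6 * (a * b) ^ 6 * (\<sigma> * \<tau>) ^ 3 * (p * q) ^ 5 * s ^ 20"
    using uv by (subst (asm) mult_le_cancel_right_pos) auto
  then show ?thesis by (simp add: u_def v_def s_def l_def a_def b_def p_def q_def)
qed

section \<open>Eliminating the energies\<close>

text \<open>The a and b are third energies, the s and t rich bounds, and the indices 1 and 2 name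
  the coordinates. A product such as a1 s1 is not controlled; only the crossed ones
  (\<open>f\<close>) and the pure energy products (\<open>e\<close>) are. So the eighth power of the
  energies is split as 5 + 3, with \<open>f\<close> used three times.\<close>

lemma combine_sumset_bounds:
  fixes m Z a1 a2 b1 b2 s1 s2 t1 t2 S T :: real
  assumes pos: "0 < m" "0 \<le> Z" "0 \<le> a1" "0 \<le> a2" "0 \<le> b1" "0 \<le> b2" "0 \<le> s1" "0 \<le> s2" "0 \<le> t1" "0 \<le> t2" "0 \<le> S" "0 \<le> T"
    and h1: "m ^ 57 \<le> Z ^ 222 * (a1 * b1) ^ 8 * (s1 * t1) ^ 3 * S ^ 38"
    and h2: "m ^ 57 \<le> Z ^ 222 * (a2 * b2) ^ 8 * (s2 * t2) ^ 3 * T ^ 38"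
    and e: "a1 * a2 * (b1 * b2) \<le> Z ^ 130 * m ^ 7"
    and f: "(a1 * s2) * (a2 * s1) * ((b1 * t2) * (b2 * t1)) \<le> Z ^ 244 * m ^ 10"
  shows "m ^ 49 \<le> Z ^ 1826 * (S ^ 38 * T ^ 38)"
proof -
  have "m ^ 49 * m ^ 65 = m ^ 57 * m ^ 57" by (simp flip: power_add)
  also have "\<dots> \<le> (Z ^ 222 * (a1 * b1) ^ 8 * (s1 * t1) ^ 3 * S ^ 38) * (Z ^ 222 * (a2 * b2) ^ 8 * (s2 * t2) ^ 3 * T ^ 38)"
    by (rule mult_mono[OF h1 h2]) (use pos in auto)
  also have "\<dots> = (a1 * a2 * (b1 * b2)) ^ 5 * ((a1 * s2) * (a2 * s1) * ((b1 * t2) * (b2 * t1))) ^ 3 * (Z ^ 444 * (S ^ 38 * T ^ 38))"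
    by algebra
  also have "\<dots> \<le> (Z ^ 130 * m ^ 7) ^ 5 * (Z ^ 244 * m ^ 10) ^ 3 * (Z ^ 444 * (S ^ 38 * T ^ 38))"
    by (rule mult_right_mono[OF mult_mono[OF power_mono[OF e] power_mono[OF f]]]) (use pos in auto)
  also have "\<dots> = (Z ^ 1826 * (S ^ 38 * T ^ 38)) * m ^ 65"
    by (simp add: power_mult_distrib mult_ac flip: power_add power_mult)
  finally show ?thesis using pos by (subst (asm) mult_le_cancel_right_pos) auto
qed

text \<open>As for sumsets, but the energies now have exponent 6 = 3 + 3, so both \<open>e\<close>
  and \<open>f\<close> are used with exponent 3.\<close>

lemma combine_diffset_bounds:
  fixes m Z a1 a2 b1 b2 s1 s2 t1 t2 S T :: real
  assumes pos: "0 < m" "0 \<le> Z" "0 \<le> a1" "0 \<le> a2" "0 \<le> b1" "0 \<le> b2" "0 \<le> s1" "0 \<le> s2" "0 \<le> t1" "0 \<le> t2" "0 \<le> S" "0 \<le> T"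
      "0 \<le> p1" "0 \<le> p2" "0 \<le> q1" "0 \<le> q2"
    and h1: "m ^ 45 \<le> Z ^ 144 * (a1 * b1) ^ 6 * (s1 * t1) ^ 3 * (p1 * q1) ^ 5 * S ^ 20"
    and h2: "m ^ 45 \<le> Z ^ 144 * (a2 * b2) ^ 6 * (s2 * t2) ^ 3 * (p2 * q2) ^ 5 * T ^ 20"
    and e: "a1 * a2 * (b1 * b2) \<le> Z ^ 130 * m ^ 7"
    and f: "(a1 * s2) * (a2 * s1) * ((b1 * t2) * (b2 * t1)) \<le> Z ^ 244 * m ^ 10"
  shows "m ^ 39 \<le> Z ^ 1410 * (S ^ 20 * T ^ 20 * p1 ^ 5 * q1 ^ 5 * p2 ^ 5 * q2 ^ 5)"
proof -
  have "m ^ 39 * m ^ 51 = m ^ 45 * m ^ 45" by (simp flip: power_add)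
  also have "\<dots> \<le> (Z ^ 144 * (a1 * b1) ^ 6 * (s1 * t1) ^ 3 * (p1 * q1) ^ 5 * S ^ 20)
      * (Z ^ 144 * (a2 * b2) ^ 6 * (s2 * t2) ^ 3 * (p2 * q2) ^ 5 * T ^ 20)"
    by (rule mult_mono[OF h1 h2]) (use pos in auto)
  also have "\<dots> = (a1 * a2 * (b1 * b2)) ^ 3 * ((a1 * s2) * (a2 * s1) * ((b1 * t2) * (b2 * t1))) ^ 3
      * (Z ^ 288 * (S ^ 20 * T ^ 20 * p1 ^ 5 * q1 ^ 5 * p2 ^ 5 * q2 ^ 5))"
    by algebra
  also have "\<dots> \<le> (Z ^ 130 * m ^ 7) ^ 3 * (Z ^ 244 * m ^ 10) ^ 3
      * (Z ^ 288 * (S ^ 20 * T ^ 20 * p1 ^ 5 * q1 ^ 5 * p2 ^ 5 * q2 ^ 5))"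
    by (rule mult_right_mono[OF mult_mono[OF power_mono[OF e] power_mono[OF f]]]) (use pos in auto)
  also have "\<dots> = (Z ^ 1410 * (S ^ 20 * T ^ 20 * p1 ^ 5 * q1 ^ 5 * p2 ^ 5 * q2 ^ 5)) * m ^ 51"
    by (simp add: power_mult_distrib mult_ac flip: power_add power_mult)
  finally show ?thesis using pos by (subst (asm) mult_le_cancel_right_pos) auto
qed

text \<open>Merges constants and powers of L into the single base 2 L, so that later only exponents
  have to be tracked.\<close>

lemma two_power_mult_power_le:
  assumes "1 \<le> L" "b \<le> a"
  shows "2 ^ a * real L ^ b \<le> (2 * real L) ^ a"
proof -
  have "real L ^ b \<le> real L ^ a" using assms by (intro power_increasing) auto
  then show ?thesis by (simp add: power_mult_distrib)
qed

text \<open>The last bound eliminates \<sigma>: the energy of the first coordinate is at most about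
  \<sigma> n^2, and \<sigma> times the energy of the second one is at most about n^5.\<close>

lemma exists_subcurve_energy_bounds:
  assumes cv: "curve I \<alpha> \<beta>" and "I \<noteq> {}" "card I \<le> 2 ^ L" "1 \<le> L"
  obtains J \<sigma> \<tau> where "J \<subseteq> I" "real (card I) \<le> (2 * real L) ^ 12 * real (card J)"
    "rich_bound (\<alpha> ` J) \<sigma>" "rich_bound (\<beta> ` J) \<tau>"
    "energy 3 (\<alpha> ` J) * \<tau> \<le> (2 * real L) ^ 61 * real (card J) ^ 5"
    "energy 3 (\<beta> ` J) * \<sigma> \<le> (2 * real L) ^ 61 * real (card J) ^ 5"
    "energy 3 (\<alpha> ` J) * energy 3 (\<beta> ` J) \<le> (2 * real L) ^ 65 * real (card J) ^ 7"
proof -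
  obtain J \<sigma> \<tau> where J: "J \<subseteq> I" "real (card I) \<le> 2 ^ 12 * real L ^ 4 * real (card J)"
    "rich_bound (\<alpha> ` J) \<sigma>" "rich_bound (\<beta> ` J) \<tau>"
    "energy 3 (\<alpha> ` J) * \<tau> \<le> 2 ^ 61 * real L ^ 23 * real (card J) ^ 5"
    "energy 3 (\<beta> ` J) * \<sigma> \<le> 2 ^ 61 * real L ^ 23 * real (card J) ^ 5"
    by (rule exists_regular_subcurve[OF assms])
  have finI: "finite I" and inj: "inj_on \<alpha> I" using cv by (auto simp: curve_def)
  define Z where "Z = 2 * real L"
  have Z1: "Z \<ge> 1" using assms(4) by (simp add: Z_def)
  have 61: "2 ^ 61 * real L ^ 23 * real (card J) ^ 5 \<le> Z ^ 61 * real (card J) ^ 5"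
    unfolding Z_def using assms(4) by (intro mult_right_mono two_power_mult_power_le) auto
  have 12: "2 ^ 12 * real L ^ 4 * real (card J) \<le> Z ^ 12 * real (card J)"
    unfolding Z_def using assms(4) by (intro mult_right_mono two_power_mult_power_le) auto
  have cJ: "card (\<alpha> ` J) = card J" using inj_on_subset[OF inj J(1)] by (rule card_image)
  have finJ: "finite J" using J(1) finI by (rule finite_subset)
  have JL: "card (\<alpha> ` J) \<le> 2 ^ L" using card_mono[OF finI J(1)] assms(3) cJ by linarith
  have "energy 3 (\<alpha> ` J) \<le> 16 * real L * \<sigma> * real (card J) ^ 2"
    using energy_le_of_rich_bound[OF J(3) _ JL assms(4)] finJ cJ by simp
  also have "16 * real L * \<sigma> * real (card J) ^ 2 \<le> Z ^ 4 * \<sigma> * real (card J) ^ 2"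
    using two_power_mult_power_le[of L 1 4] assms(4) rich_bound_nonneg[OF J(3)]
    unfolding Z_def by (intro mult_right_mono) auto
  finally have "energy 3 (\<alpha> ` J) * energy 3 (\<beta> ` J) \<le> (Z ^ 4 * \<sigma> * real (card J) ^ 2) * energy 3 (\<beta> ` J)"
    by (intro mult_right_mono energy_nonneg)
  also have "\<dots> = Z ^ 4 * real (card J) ^ 2 * (energy 3 (\<beta> ` J) * \<sigma>)" by simp
  also have "\<dots> \<le> Z ^ 4 * real (card J) ^ 2 * (Z ^ 61 * real (card J) ^ 5)"
    using order_trans[OF J(6) 61] Z1 by (intro mult_left_mono) auto
  also have "\<dots> = Z ^ 65 * real (card J) ^ 7" by (simp add: mult_ac flip: power_add)
  finally have 7: "energy 3 (\<alpha> ` J) * energy 3 (\<beta> ` J) \<le> Z ^ 65 * real (card J) ^ 7" .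
  show thesis
    by (rule that[OF J(1) order_trans[OF J(2) 12, unfolded Z_def] J(3,4)
        order_trans[OF J(5) 61, unfolded Z_def] order_trans[OF J(6) 61, unfolded Z_def] 7[unfolded Z_def]])
qed

theorem curve_sumset_bounds:
  assumes cI: "curve I \<alpha> \<beta>" and cJ: "curve J \<gamma> \<delta>" and ne: "I \<noteq> {}" "J \<noteq> {}"
    and L: "card I \<le> 2 ^ L" "card J \<le> 2 ^ L" "1 \<le> L"
  shows "(real (card I) * real (card J)) ^ 49 \<le> (2 * real L) ^ 3002
      * (real (card (sumset (\<alpha> ` I) (\<gamma> ` J))) ^ 38 * real (card (sumset (\<beta> ` I) (\<delta> ` J))) ^ 38)" (is ?first)
    and "(real (card I) * real (card J)) ^ 39 \<le> (2 * real L) ^ 3002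
      * (real (card (sumset (\<alpha> ` I) (\<gamma> ` J))) ^ 20 * real (card (sumset (\<beta> ` I) (\<delta> ` J))) ^ 20
        * real (card (diffset (\<alpha> ` I) (\<alpha> ` I))) ^ 5 * real (card (diffset (\<gamma> ` J) (\<gamma> ` J))) ^ 5
        * real (card (diffset (\<beta> ` I) (\<beta> ` I))) ^ 5 * real (card (diffset (\<delta> ` J) (\<delta> ` J))) ^ 5)" (is ?second)
proof -
  define Z where "Z = 2 * real L"
  obtain I' s1 s2 where I': "I' \<subseteq> I" "real (card I) \<le> Z ^ 12 * real (card I')"
    "rich_bound (\<alpha> ` I') s1" "rich_bound (\<beta> ` I') s2"
    "energy 3 (\<alpha> ` I') * s2 \<le> Z ^ 61 * real (card I') ^ 5"
    "energy 3 (\<beta> ` I') * s1 \<le> Z ^ 61 * real (card I') ^ 5"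
    "energy 3 (\<alpha> ` I') * energy 3 (\<beta> ` I') \<le> Z ^ 65 * real (card I') ^ 7"
    unfolding Z_def by (rule exists_subcurve_energy_bounds[OF cI ne(1) L(1,3)])
  obtain J' t1 t2 where J': "J' \<subseteq> J" "real (card J) \<le> Z ^ 12 * real (card J')"
    "rich_bound (\<gamma> ` J') t1" "rich_bound (\<delta> ` J') t2"
    "energy 3 (\<gamma> ` J') * t2 \<le> Z ^ 61 * real (card J') ^ 5"
    "energy 3 (\<delta> ` J') * t1 \<le> Z ^ 61 * real (card J') ^ 5"
    "energy 3 (\<gamma> ` J') * energy 3 (\<delta> ` J') \<le> Z ^ 65 * real (card J') ^ 7"
    unfolding Z_def by (rule exists_subcurve_energy_bounds[OF cJ ne(2) L(2,3)])
  have Z1: "Z \<ge> 1" using L(3) by (simp add: Z_def)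
  have fin: "finite I" "finite J" using cI cJ by (auto simp: curve_def)
  have fin': "finite I'" "finite J'" using I'(1) J'(1) fin finite_subset by blast+
  have card_eq: "card (\<alpha> ` I') = card I'" "card (\<beta> ` I') = card I'" "card (\<gamma> ` J') = card J'" "card (\<delta> ` J') = card J'"
    using curve_subset[OF cI I'(1)] curve_subset[OF cJ J'(1)] by (auto simp: curve_def card_image)
  have "real (card I) > 0" "real (card J) > 0" using fin ne by (auto simp: card_gt_0_iff)
  then have "card I' \<noteq> 0" "card J' \<noteq> 0" using I'(2) J'(2) by - (rule notI, simp)+
  then have ne': "I' \<noteq> {}" "J' \<noteq> {}" by auto
  have L': "card I' \<le> 2 ^ L" "card J' \<le> 2 ^ L"
    using card_mono[OF fin(1) I'(1)] card_mono[OF fin(2) J'(1)] L by linarith+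
  define m where "m = real (card I') * real (card J')"
  have mp: "m > 0" using ne' fin' by (simp add: m_def card_gt_0_iff)
  define a1 where "a1 = energy 3 (\<alpha> ` I')"
  define a2 where "a2 = energy 3 (\<beta> ` I')"
  define b1 where "b1 = energy 3 (\<gamma> ` J')"
  define b2 where "b2 = energy 3 (\<delta> ` J')"
  define S where "S = real (card (sumset (\<alpha> ` I') (\<gamma> ` J')))"
  define T where "T = real (card (sumset (\<beta> ` I') (\<delta> ` J')))"
  define p1 where "p1 = real (card (diffset (\<alpha> ` I') (\<alpha> ` I')))"
  define p2 where "p2 = real (card (diffset (\<beta> ` I') (\<beta> ` I')))"
  define q1 where "q1 = real (card (diffset (\<gamma> ` J') (\<gamma> ` J')))"
  define q2 where "q2 = real (card (diffset (\<delta> ` J') (\<delta> ` J')))"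
  note defs = a1_def a2_def b1_def b2_def S_def T_def p1_def p2_def q1_def q2_def
  have pos: "0 < m" "0 \<le> Z" "0 \<le> a1" "0 \<le> a2" "0 \<le> b1" "0 \<le> b2" "0 \<le> s1" "0 \<le> s2" "0 \<le> t1" "0 \<le> t2" "0 \<le> S" "0 \<le> T"
    and pos': "0 \<le> p1" "0 \<le> p2" "0 \<le> q1" "0 \<le> q2"
    using mp Z1 rich_bound_nonneg[OF I'(3)] rich_bound_nonneg[OF I'(4)]
      rich_bound_nonneg[OF J'(3)] rich_bound_nonneg[OF J'(4)] by (auto simp: defs energy_nonneg)
  have e: "a1 * a2 * (b1 * b2) \<le> Z ^ 130 * m ^ 7"
  proof -
    have "a1 * a2 * (b1 * b2) \<le> (Z ^ 65 * real (card I') ^ 7) * (Z ^ 65 * real (card J') ^ 7)"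
      by (rule mult_mono) (use I'(7) J'(7) Z1 in \<open>auto simp: defs intro!: mult_nonneg_nonneg energy_nonneg\<close>)
    also have "\<dots> = Z ^ 130 * m ^ 7" by (simp add: m_def power_mult_distrib mult_ac flip: power_add)
    finally show ?thesis .
  qed
  have f: "(a1 * s2) * (a2 * s1) * ((b1 * t2) * (b2 * t1)) \<le> Z ^ 244 * m ^ 10"
  proof -
    have A: "(a1 * s2) * (a2 * s1) \<le> (Z ^ 61 * real (card I') ^ 5) * (Z ^ 61 * real (card I') ^ 5)"
      by (rule mult_mono[OF I'(5,6)[folded defs]]) (use pos in auto)
    have B: "(b1 * t2) * (b2 * t1) \<le> (Z ^ 61 * real (card J') ^ 5) * (Z ^ 61 * real (card J') ^ 5)"
      by (rule mult_mono[OF J'(5,6)[folded defs]]) (use pos in auto)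
    have "(a1 * s2) * (a2 * s1) * ((b1 * t2) * (b2 * t1))
      \<le> ((Z ^ 61 * real (card I') ^ 5) * (Z ^ 61 * real (card I') ^ 5)) * ((Z ^ 61 * real (card J') ^ 5) * (Z ^ 61 * real (card J') ^ 5))"
      by (rule mult_mono[OF A B]) (use pos in auto)
    also have "\<dots> = Z ^ 244 * m ^ 10" unfolding m_def by algebra
    finally show ?thesis .
  qed
  have Zp: "2 ^ a * real L ^ b * y \<le> Z ^ a * y" if "b \<le> a" "0 \<le> y" for a b y
    unfolding Z_def using that L(3) by (intro mult_right_mono two_power_mult_power_le) auto
  have fins: "finite (\<alpha> ` I')" "finite (\<beta> ` I')" "finite (\<gamma> ` J')" "finite (\<delta> ` J')" using fin' by auto
  have nes: "\<alpha> ` I' \<noteq> {}" "\<beta> ` I' \<noteq> {}" "\<gamma> ` J' \<noteq> {}" "\<delta> ` J' \<noteq> {}" using ne' by auto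
  note Ls = L'(1)[folded card_eq(1)] L'(1)[folded card_eq(2)] L'(2)[folded card_eq(3)] L'(2)[folded card_eq(4)]
  have "m ^ 57 \<le> 2 ^ 222 * real L ^ 24 * ((a1 * b1) ^ 8 * (s1 * t1) ^ 3 * S ^ 38)"
    using sumset_energy_bound[OF fins(1,3) nes(1,3) I'(3) J'(3) Ls(1,3) L(3)]
    unfolding card_eq m_def defs by (simp only: mult.assoc)
  also have "\<dots> \<le> Z ^ 222 * ((a1 * b1) ^ 8 * (s1 * t1) ^ 3 * S ^ 38)" by (rule Zp) (use pos in auto)
  finally have h1: "m ^ 57 \<le> Z ^ 222 * (a1 * b1) ^ 8 * (s1 * t1) ^ 3 * S ^ 38" by (simp only: mult.assoc)
  have "m ^ 57 \<le> 2 ^ 222 * real L ^ 24 * ((a2 * b2) ^ 8 * (s2 * t2) ^ 3 * T ^ 38)"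
    using sumset_energy_bound[OF fins(2,4) nes(2,4) I'(4) J'(4) Ls(2,4) L(3)]
    unfolding card_eq m_def defs by (simp only: mult.assoc)
  also have "\<dots> \<le> Z ^ 222 * ((a2 * b2) ^ 8 * (s2 * t2) ^ 3 * T ^ 38)" by (rule Zp) (use pos in auto)
  finally have h2: "m ^ 57 \<le> Z ^ 222 * (a2 * b2) ^ 8 * (s2 * t2) ^ 3 * T ^ 38" by (simp only: mult.assoc)
  have "m ^ 45 \<le> 2 ^ 144 * real L ^ 6 * ((a1 * b1) ^ 6 * (s1 * t1) ^ 3 * (p1 * q1) ^ 5 * S ^ 20)"
    using diffset_energy_bound[OF fins(1,3) nes(1,3) I'(3) J'(3) Ls(1,3) L(3)]
    unfolding card_eq m_def defs by (simp only: mult.assoc)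
  also have "\<dots> \<le> Z ^ 144 * ((a1 * b1) ^ 6 * (s1 * t1) ^ 3 * (p1 * q1) ^ 5 * S ^ 20)" by (rule Zp) (use pos pos' in auto)
  finally have k1: "m ^ 45 \<le> Z ^ 144 * (a1 * b1) ^ 6 * (s1 * t1) ^ 3 * (p1 * q1) ^ 5 * S ^ 20" by (simp only: mult.assoc)
  have "m ^ 45 \<le> 2 ^ 144 * real L ^ 6 * ((a2 * b2) ^ 6 * (s2 * t2) ^ 3 * (p2 * q2) ^ 5 * T ^ 20)"
    using diffset_energy_bound[OF fins(2,4) nes(2,4) I'(4) J'(4) Ls(2,4) L(3)]
    unfolding card_eq m_def defs by (simp only: mult.assoc)
  also have "\<dots> \<le> Z ^ 144 * ((a2 * b2) ^ 6 * (s2 * t2) ^ 3 * (p2 * q2) ^ 5 * T ^ 20)" by (rule Zp) (use pos pos' in auto)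
  finally have k2: "m ^ 45 \<le> Z ^ 144 * (a2 * b2) ^ 6 * (s2 * t2) ^ 3 * (p2 * q2) ^ 5 * T ^ 20" by (simp only: mult.assoc)
  have Im: "real (card I) * real (card J) \<le> Z ^ 24 * m"
  proof -
    have "real (card I) * real (card J) \<le> (Z ^ 12 * real (card I')) * (Z ^ 12 * real (card J'))"
      by (rule mult_mono[OF I'(2) J'(2)]) (use Z1 in auto)
    also have "\<dots> = Z ^ 24 * m" by (simp add: m_def mult_ac flip: power_add)
    finally show ?thesis .
  qed
  have S: "S \<le> real (card (sumset (\<alpha> ` I) (\<gamma> ` J)))" "T \<le> real (card (sumset (\<beta> ` I) (\<delta> ` J)))"
    unfolding defs by (intro of_nat_mono card_mono finite_sumset sumset_mono image_mono finite_imageI fin I'(1) J'(1))+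
  have D: "p1 \<le> real (card (diffset (\<alpha> ` I) (\<alpha> ` I)))" "p2 \<le> real (card (diffset (\<beta> ` I) (\<beta> ` I)))"
    "q1 \<le> real (card (diffset (\<gamma> ` J) (\<gamma> ` J)))" "q2 \<le> real (card (diffset (\<delta> ` J) (\<delta> ` J)))"
    unfolding defs by (intro of_nat_mono card_mono finite_diffset diffset_mono image_mono finite_imageI fin I'(1) J'(1))+
  \<comment> \<open>Returning from I' and J' to I and J costs Z^24 per factor m. The exponent 3002 =
    24 * 49 + 1826 is exact for the first estimate; the second needs only 24 * 39 + 1410 =
    2346.\<close>
  have lift: "(real (card I) * real (card J)) ^ k \<le> Z ^ 3002 * Y"
    if "m ^ k \<le> Z ^ r * y" "y \<le> Y" "0 \<le> y" "24 * k + r \<le> 3002" for k r y Y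
  proof -
    have "(real (card I) * real (card J)) ^ k \<le> (Z ^ 24 * m) ^ k" using Im by (intro power_mono) auto
    also have "\<dots> = Z ^ (24 * k) * m ^ k" by (simp add: power_mult_distrib power_mult)
    also have "\<dots> \<le> Z ^ (24 * k) * (Z ^ r * y)" using that(1) Z1 by (intro mult_left_mono) auto
    also have "\<dots> = Z ^ (24 * k + r) * y" by (simp add: power_add)
    also have "\<dots> \<le> Z ^ 3002 * Y" using that Z1 by (intro mult_mono power_increasing) auto
    finally show ?thesis .
  qed
  show ?first
    unfolding Z_def[symmetric]
  proof (rule lift[OF combine_sumset_bounds[OF pos h1 h2 e f]])
    show "S ^ 38 * T ^ 38 \<le> real (card (sumset (\<alpha> ` I) (\<gamma> ` J))) ^ 38 * real (card (sumset (\<beta> ` I) (\<delta> ` J))) ^ 38"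
      by (intro mult_mono power_mono S) (use pos in auto)
  qed (use pos in auto)
  show ?second
    unfolding Z_def[symmetric]
  proof (rule lift[OF combine_diffset_bounds[OF pos pos'(1,2,3,4) k1 k2 e f]])
    show "S ^ 20 * T ^ 20 * p1 ^ 5 * q1 ^ 5 * p2 ^ 5 * q2 ^ 5
      \<le> real (card (sumset (\<alpha> ` I) (\<gamma> ` J))) ^ 20 * real (card (sumset (\<beta> ` I) (\<delta> ` J))) ^ 20
        * real (card (diffset (\<alpha> ` I) (\<alpha> ` I))) ^ 5 * real (card (diffset (\<gamma> ` J) (\<gamma> ` J))) ^ 5
        * real (card (diffset (\<beta> ` I) (\<beta> ` I))) ^ 5 * real (card (diffset (\<delta> ` J) (\<delta> ` J))) ^ 5"
      by (intro mult_mono power_mono S D) (use pos pos' in \<open>auto intro!: mult_nonneg_nonneg\<close>)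
  qed (use pos pos' in auto)
qed

section \<open>Convex functions\<close>

text \<open>A reflection merely exchanges the increasing and decreasing alternatives. It serves for
  concave functions as well as for differences in place of sums.\<close>

lemma curve_uminus_left: "curve I \<alpha> \<beta> \<Longrightarrow> curve I (\<lambda>i. - \<alpha> i) \<beta>"
  unfolding curve_def
proof (elim conjE, intro conjI)
  assume "inj_on \<alpha> I"
  then show "inj_on (\<lambda>i. - \<alpha> i) I" by (simp add: inj_on_def)
next
  assume "(\<forall>i\<in>I. \<forall>j\<in>I. \<alpha> i < \<alpha> j \<longleftrightarrow> \<beta> i < \<beta> j) \<or> (\<forall>i\<in>I. \<forall>j\<in>I. \<alpha> i < \<alpha> j \<longleftrightarrow> \<beta> j < \<beta> i)"
  then show "(\<forall>i\<in>I. \<forall>j\<in>I. - \<alpha> i < - \<alpha> j \<longleftrightarrow> \<beta> i < \<beta> j) \<or> (\<forall>i\<in>I. \<forall>j\<in>I. - \<alpha> i < - \<alpha> j \<longleftrightarrow> \<beta> j < \<beta> i)"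
    by auto
next
  assume *: "\<forall>i\<in>I. \<forall>j\<in>I. \<forall>k\<in>I. \<forall>l\<in>I.
      \<alpha> i - \<alpha> j = \<alpha> k - \<alpha> l \<longrightarrow> \<beta> i - \<beta> j = \<beta> k - \<beta> l \<longrightarrow> i = j \<or> i = k"
  have "\<alpha> i - \<alpha> j = \<alpha> k - \<alpha> l" if "- \<alpha> i - - \<alpha> j = - \<alpha> k - - \<alpha> l" for i j k l
    using that by linarith
  with * show "\<forall>i\<in>I. \<forall>j\<in>I. \<forall>k\<in>I. \<forall>l\<in>I.
      - \<alpha> i - - \<alpha> j = - \<alpha> k - - \<alpha> l \<longrightarrow> \<beta> i - \<beta> j = \<beta> k - \<beta> l \<longrightarrow> i = j \<or> i = k"
    by blast
qed

lemma curve_uminus_right: "curve I \<alpha> \<beta> \<Longrightarrow> curve I \<alpha> (\<lambda>i. - \<beta> i)"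
  by (rule curve_swap[OF curve_uminus_left[OF curve_swap]])

section \<open>Strict convexity gives monotone Sidon curves\<close>

lemma strictly_convex_on_less_max:
  assumes "strictly_convex_on S f" "x \<in> S" "z \<in> S" "x < y" "y < z"
  shows "f y < max (f x) (f z)"
proof -
  define v where "v = (y - x) / (z - x)"
  define u where "u = 1 - v"
  have v: "0 < v" "v < 1" using assms by (auto simp: v_def)
  have "v * (z - x) = y - x" using assms by (simp add: v_def)
  then have y: "y = u * x + v * z" by (simp add: u_def algebra_simps)
  have "f y < u * f x + v * f z"
    unfolding y using assms v by (auto simp: strictly_convex_on_def u_def)
  also have "\<dots> \<le> u * max (f x) (f z) + v * max (f x) (f z)"
    using v by (intro add_mono mult_left_mono) (auto simp: u_def)
  also have "\<dots> = max (f x) (f z)" by (simp add: u_def algebra_simps)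
  finally show ?thesis .
qed

text \<open>Both y and x + h are convex combinations of x and y + h, with the weights interchanged;
  adding the two convexity inequalities makes the weights sum to one.\<close>

lemma strictly_convex_on_increment:
  assumes f: "strictly_convex_on S f" and S: "x \<in> S" "y + h \<in> S" and "x < y" "0 < h"
  shows "f (x + h) - f x < f (y + h) - f y"
proof -
  define v where "v = (y - x) / (y + h - x)"
  define u where "u = 1 - v"
  have v: "0 < v" "v < 1" using assms by (auto simp: v_def)
  have e: "v * (y + h - x) = y - x" using assms by (simp add: v_def)
  have y: "y = u * x + v * (y + h)" using e by (simp add: u_def algebra_simps)
  have xh: "x + h = v * x + u * (y + h)" using e by (simp add: u_def algebra_simps)
  have "f (u * x + v * (y + h)) < u * f x + v * f (y + h)" "f (v * x + u * (y + h)) < v * f x + u * f (y + h)"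
    using assms v by (auto simp: strictly_convex_on_def u_def)
  then have "f y < u * f x + v * f (y + h)" "f (x + h) < v * f x + u * f (y + h)"
    using y xh by simp_all
  then have "f y + f (x + h) < (u + v) * f x + (u + v) * f (y + h)" by (simp add: algebra_simps)
  then show ?thesis by (simp add: u_def)
qed

lemma strictly_convex_on_sidon:
  assumes f: "strictly_convex_on S f" and S: "i \<in> S" "j \<in> S" "k \<in> S" "l \<in> S"
    and e: "i - j = k - l" "f i - f j = f k - f l" and "i \<noteq> j"
  shows "i = k"
proof -
  have False if *: "strictly_convex_on S f" "i \<in> S" "j \<in> S" "k \<in> S" "l \<in> S"
    "i - j = k - l" "f i - f j = f k - f l" "j < i" "j < l" for i j k l
  proof -
    have "f (j + (i - j)) - f j < f (l + (i - j)) - f l"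
      by (rule strictly_convex_on_increment[OF *(1)]) (use * in auto)
    moreover have "j + (i - j) = i" "l + (i - j) = k" using * by linarith+
    ultimately have "f i - f j < f k - f l" by metis
    then show False using * by linarith
  qed
  note R = this
  \<comment> \<open>Reversing both differences or exchanging the two pairs preserves the equations,
    so each of the four order cases is an instance of \<open>R\<close>.\<close>
  show ?thesis
  proof (rule ccontr)
    assume "i \<noteq> k"
    then have "j < l \<or> l < j" using e by linarith
    moreover have "j < i \<or> i < j" using \<open>i \<noteq> j\<close> by linarith
    ultimately show False
    proof (elim disjE)
      assume "j < l" "j < i" then show False using R[of i j k l] assms by simp
    next
      assume "j < l" "i < j" then show False using R[of j i l k] assms by simp
    next
      assume "l < j" "j < i" then show False using R[of k l i j] assms by simp
    next
      assume "l < j" "i < j" then show False using R[of l k j i] assms by simp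
    qed
  qed
qed

lemma curve_of_strict_mono:
  assumes "strictly_convex_on S f" "finite A" "A \<subseteq> S"
    and "(\<forall>x\<in>A. \<forall>y\<in>A. x < y \<longrightarrow> f x < f y) \<or> (\<forall>x\<in>A. \<forall>y\<in>A. x < y \<longrightarrow> f y < f x)"
  shows "curve A (\<lambda>x. x) f"
  unfolding curve_def
proof (intro conjI ballI impI)
  show "inj_on f A" using assms(4) by (intro inj_onI) (metis less_irrefl linorder_neqE_linordered_idom)
  show "(\<forall>i\<in>A. \<forall>j\<in>A. i < j \<longleftrightarrow> f i < f j) \<or> (\<forall>i\<in>A. \<forall>j\<in>A. i < j \<longleftrightarrow> f j < f i)"
    using assms(4)
  proof
    assume *: "\<forall>x\<in>A. \<forall>y\<in>A. x < y \<longrightarrow> f x < f y"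
    show ?thesis by (rule disjI1) (metis * less_asym less_irrefl linorder_neqE_linordered_idom)
  next
    assume *: "\<forall>x\<in>A. \<forall>y\<in>A. x < y \<longrightarrow> f y < f x"
    show ?thesis by (rule disjI2) (metis * less_asym less_irrefl linorder_neqE_linordered_idom)
  qed
next
  fix i j k l assume "i \<in> A" "j \<in> A" "k \<in> A" "l \<in> A" "i - j = k - l" "f i - f j = f k - f l"
  then show "i = j \<or> i = k" using strictly_convex_on_sidon[OF assms(1), of i j k l] assms(3) by blast
qed (use assms in auto)

text \<open>On A the function decreases strictly up to a minimiser c and increases strictly from
  there on, so the larger of the two parts contains at least half of A.\<close>

lemma strictly_convex_exists_subcurve:
  assumes f: "strictly_convex_on S f" and A: "finite A" "A \<subseteq> S" "A \<noteq> {}"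
  obtains A' where "A' \<subseteq> A" "card A \<le> 2 * card A'" "curve A' (\<lambda>x. x) f"
proof -
  define mn where "mn = Min (f ` A)"
  \<comment> \<open>The minimum over A may be attained twice; taking the largest minimiser makes the
    comparison with \<open>f c\<close> strict to the right of c.\<close>
  define c where "c = Max {a \<in> A. f a = mn}"
  have "mn \<in> f ` A" unfolding mn_def using A by (intro Min_in) auto
  then have "c \<in> {a \<in> A. f a = mn}" unfolding c_def using A by (intro Max_in) auto
  then have c: "c \<in> A" "f c = mn" by auto
  have le: "f c \<le> f a" if "a \<in> A" for a using that A unfolding c(2) mn_def by simp
  have lt: "f c < f a" if "a \<in> A" "c < a" for a
  proof -
    have "f a \<noteq> mn"
    proof
      assume "f a = mn"
      then have "a \<le> c" unfolding c_def using that A by (intro Max_ge) auto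
      then show False using that by simp
    qed
    then show ?thesis using le[OF that(1)] c(2) by simp
  qed
  define A1 where "A1 = {a \<in> A. a < c}"
  define A2 where "A2 = {a \<in> A. c \<le> a}"
  have "card A = card (A1 \<union> A2)" by (rule arg_cong[where f = card]) (auto simp: A1_def A2_def)
  also have "\<dots> \<le> card A1 + card A2" by (rule card_Un_le)
  finally have "card A \<le> 2 * card A1 \<or> card A \<le> 2 * card A2" by linarith
  then show thesis
  proof
    assume h: "card A \<le> 2 * card A1"
    have "f y < f x" if xy: "x \<in> A1" "y \<in> A1" "x < y" for x y
    proof -
      have "f y < max (f x) (f c)"
        using xy A c by (intro strictly_convex_on_less_max[OF f]) (auto simp: A1_def)
      then show ?thesis using le[of x] xy by (simp add: A1_def)
    qed
    then have "curve A1 (\<lambda>x. x) f" using A by (intro curve_of_strict_mono[OF f]) (auto simp: A1_def)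
    with h show thesis by (intro that[of A1]) (auto simp: A1_def)
  next
    assume h: "card A \<le> 2 * card A2"
    have "f x < f y" if xy: "x \<in> A2" "y \<in> A2" "x < y" for x y
    proof (cases "x = c")
      case True
      then show ?thesis using lt xy by (simp add: A2_def)
    next
      case False
      then have "f x < max (f c) (f y)"
        using xy A c by (intro strictly_convex_on_less_max[OF f]) (auto simp: A2_def)
      then show ?thesis using le[of y] xy by (simp add: A2_def)
    qed
    then have "curve A2 (\<lambda>x. x) f" using A by (intro curve_of_strict_mono[OF f]) (auto simp: A2_def)
    with h show thesis by (intro that[of A2]) (auto simp: A2_def)
  qed
qed

lemma exists_subcurve:
  assumes f: "strictly_convex_on S f \<or> strictly_concave_on S f" and A: "finite A" "A \<subseteq> S" "A \<noteq> {}"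
  obtains A' where "A' \<subseteq> A" "card A \<le> 2 * card A'" "curve A' (\<lambda>x. x) f"
  using f
proof
  assume "strictly_convex_on S f"
  then show thesis using strictly_convex_exists_subcurve[OF _ A] that by blast
next
  assume "strictly_concave_on S f"
  then have "strictly_convex_on S (\<lambda>x. - f x)" by (simp add: strictly_concave_on_def)
  then obtain A' where A': "A' \<subseteq> A" "card A \<le> 2 * card A'" "curve A' (\<lambda>x. x) (\<lambda>x. - f x)"
    using strictly_convex_exists_subcurve[OF _ A] by blast
  have "curve A' (\<lambda>x. x) f" using curve_uminus_right[OF A'(3)] by simp
  with A' that show thesis by blast
qed

section \<open>Signs, logarithms and the final estimate\<close>

text \<open>A difference is a sum with the reflected second set, and reflection does not change that
  set's own difference set, so one argument covers all choices of sign.\<close>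

lemma sumset_or_diffset:
  assumes "pm \<in> {sumset, diffset}"
  obtains \<epsilon> :: "real \<Rightarrow> real" where "\<epsilon> = (\<lambda>x. x) \<or> \<epsilon> = uminus"
    "\<And>X Y. pm X Y = sumset X (\<epsilon> ` Y)" "\<And>Y. diffset (\<epsilon> ` Y) (\<epsilon> ` Y) = diffset Y Y"
proof (cases "pm = sumset")
  case True
  show thesis by (rule that[of "\<lambda>x. x"]) (auto simp: True)
next
  case False
  then have pm: "pm = diffset" using assms by auto
  show thesis
  proof (rule that[of uminus])
    show "pm X Y = sumset X (uminus ` Y)" for X Y
      unfolding pm diffset_eq_image sumset_eq_image by force
    show "diffset (uminus ` Y) (uminus ` Y) = diffset Y Y" for Y :: "real set"
    proof (intro equalityI subsetI)
      fix x assume "x \<in> diffset (uminus ` Y) (uminus ` Y)"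
      then obtain a b where "a \<in> Y" "b \<in> Y" "x = b - a" by (auto simp: diffset_def)
      then show "x \<in> diffset Y Y" unfolding diffset_def by blast
    next
      fix x assume "x \<in> diffset Y Y"
      then obtain a b where "a \<in> Y" "b \<in> Y" "x = - b - - a" by (auto simp: diffset_def)
      then show "x \<in> diffset (uminus ` Y) (uminus ` Y)" unfolding diffset_def by blast
    qed
  qed simp
qed

text \<open>From \<open>2 \<le> n\<close> the binary logarithm is at least 1, so rounding it up at
  most doubles it.\<close>

lemma log_exponent:
  assumes "2 \<le> n"
  obtains L :: nat where "1 \<le> L" "n \<le> 2 ^ L" "2 * real L \<le> 4 / ln 2 * ln (real n)"
proof -
  define L where "L = nat \<lceil>log 2 (real n)\<rceil>"
  have l1: "1 \<le> log 2 (real n)" using assms by (simp add: le_log_iff)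
  have "log 2 (real n) \<le> real L" unfolding L_def by linarith
  then have "real n \<le> 2 powr real L" using assms by (simp add: log_le_iff)
  then have "real n \<le> real (2 ^ L)" by (simp add: powr_realpow)
  then have 1: "n \<le> 2 ^ L" by (simp only: of_nat_le_iff)
  have 2: "real L \<le> 2 * log 2 (real n)" using l1 unfolding L_def by linarith
  have "1 \<le> L" using l1 \<open>log 2 (real n) \<le> real L\<close> by linarith
  then show thesis using 1 2 by (intro that[of L]) (auto simp: log_def)
qed

lemma convex_sumset_bounds:
  assumes f: "strictly_convex_on S f \<or> strictly_concave_on S f"
    and g: "strictly_convex_on T g \<or> strictly_concave_on T g"
    and A: "finite A" "A \<subseteq> S" and B: "finite B" "B \<subseteq> T" and n: "2 \<le> card A * card B"
    and pm: "pm1 \<in> {sumset, diffset}" "pm2 \<in> {sumset, diffset}"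
  shows "real (card A) ^ 49 * real (card B) ^ 49
        \<le> (4 / ln 2 * ln (real (card A * card B))) ^ 3100
          * (real (card (pm1 A B)) ^ 38 * real (card (pm2 (f ` A) (g ` B))) ^ 38)" (is ?first)
    and "real (card A) ^ 39 * real (card B) ^ 39
        \<le> (4 / ln 2 * ln (real (card A * card B))) ^ 3100
          * (real (card (pm1 A B)) ^ 20 * real (card (pm2 (f ` A) (g ` B))) ^ 20
                 * real (card (diffset A A)) ^ 5 * real (card (diffset B B)) ^ 5
                 * real (card (diffset (f ` A) (f ` A))) ^ 5
                 * real (card (diffset (g ` B) (g ` B))) ^ 5)" (is ?second)
proof -
  obtain L where L: "1 \<le> L" "card A * card B \<le> 2 ^ L" "2 * real L \<le> 4 / ln 2 * ln (real (card A * card B))"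
    by (rule log_exponent[OF n])
  define Z where "Z = 2 * real L"
  have Z2: "2 \<le> Z" using L(1) by (simp add: Z_def)
  have cp: "1 \<le> card A" "1 \<le> card B" using n by (auto simp: Suc_le_eq intro!: gr0I)
  then have ne: "A \<noteq> {}" "B \<noteq> {}" by auto
  obtain A' where A': "A' \<subseteq> A" "card A \<le> 2 * card A'" "curve A' (\<lambda>x. x) f"
    by (rule exists_subcurve[OF f A ne(1)])
  obtain B' where B': "B' \<subseteq> B" "card B \<le> 2 * card B'" "curve B' (\<lambda>x. x) g"
    by (rule exists_subcurve[OF g B ne(2)])
  obtain \<gamma> where \<gamma>: "\<gamma> = (\<lambda>x. x) \<or> \<gamma> = uminus" "\<And>X Y. pm1 X Y = sumset X (\<gamma> ` Y)" "\<And>Y. diffset (\<gamma> ` Y) (\<gamma> ` Y) = diffset Y Y"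
    using sumset_or_diffset[OF pm(1)] by metis
  obtain \<delta> where \<delta>: "\<delta> = (\<lambda>x. x) \<or> \<delta> = uminus" "\<And>X Y. pm2 X Y = sumset X (\<delta> ` Y)" "\<And>Y. diffset (\<delta> ` Y) (\<delta> ` Y) = diffset Y Y"
    using sumset_or_diffset[OF pm(2)] by metis
  \<comment> \<open>The signs become reflections of the two coordinates over B'. Each coordinate may
    be reflected on its own, so the two signs are independent.\<close>
  have "curve B' \<gamma> g" using \<gamma>(1) B'(3) curve_uminus_left[OF B'(3)] by auto
  then have cB: "curve B' \<gamma> (\<lambda>x. \<delta> (g x))" using \<delta>(1) curve_uminus_right[of B' \<gamma> g] by auto
  have ne': "A' \<noteq> {}" "B' \<noteq> {}" using A'(2) B'(2) cp by auto
  have "card A' \<le> card A" "card B' \<le> card B" using A'(1) B'(1) A(1) B(1) by (auto intro: card_mono)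
  moreover have "card A \<le> card A * card B" "card B \<le> card A * card B" using cp by auto
  ultimately have c': "card A' \<le> 2 ^ L" "card B' \<le> 2 ^ L" using L(2) by linarith+
  note main = curve_sumset_bounds[OF A'(3) cB ne' c' L(1), folded Z_def]
  have img: "(\<lambda>x. \<delta> (g x)) ` X = \<delta> ` (g ` X)" for X by (simp add: image_image)
  have S: "real (card (sumset ((\<lambda>x. x) ` A') (\<gamma> ` B'))) \<le> real (card (pm1 A B))"
    "real (card (sumset (f ` A') ((\<lambda>x. \<delta> (g x)) ` B'))) \<le> real (card (pm2 (f ` A) (g ` B)))"
    unfolding \<gamma>(2) \<delta>(2) img using A' B' A B
    by (intro of_nat_mono card_mono finite_sumset sumset_mono; auto)+
  have D: "real (card (diffset ((\<lambda>x. x) ` A') ((\<lambda>x. x) ` A'))) \<le> real (card (diffset A A))"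
    "real (card (diffset (\<gamma> ` B') (\<gamma> ` B'))) \<le> real (card (diffset B B))"
    "real (card (diffset (f ` A') (f ` A'))) \<le> real (card (diffset (f ` A) (f ` A)))"
    "real (card (diffset ((\<lambda>x. \<delta> (g x)) ` B') ((\<lambda>x. \<delta> (g x)) ` B'))) \<le> real (card (diffset (g ` B) (g ` B)))"
    unfolding \<gamma>(3) \<delta>(3) img using A' B' A B
    by (intro of_nat_mono card_mono finite_diffset diffset_mono; auto)+
  \<comment> \<open>Halving A and B costs 4 \<le> Z^2 per factor, so 3002 + 2 * 49 = 3100 suffices
    for both exponents.\<close>
  have lift: "real (card A) ^ k * real (card B) ^ k \<le> (4 / ln 2 * ln (real (card A * card B))) ^ 3100 * Y"
    if "(real (card A') * real (card B')) ^ k \<le> Z ^ 3002 * y" "y \<le> Y" "0 \<le> y" "k \<le> 49" for k y Y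
  proof -
    have "real (card A) \<le> 2 * real (card A')" "real (card B) \<le> 2 * real (card B')"
      using A'(2) B'(2) by linarith+
    then have "real (card A) * real (card B) \<le> (2 * real (card A')) * (2 * real (card B'))"
      by (intro mult_mono) auto
    also have "\<dots> \<le> Z ^ 2 * (real (card A') * real (card B'))"
      using power_mono[OF Z2, of 2] by (simp add: mult_right_mono)
    finally have "(real (card A) * real (card B)) ^ k \<le> (Z ^ 2 * (real (card A') * real (card B'))) ^ k"
      by (intro power_mono) auto
    also have "\<dots> = Z ^ (2 * k) * (real (card A') * real (card B')) ^ k"
      by (simp add: power_mult_distrib power_mult)
    also have "\<dots> \<le> Z ^ (2 * k) * (Z ^ 3002 * y)" using that(1) Z2 by (intro mult_left_mono) auto
    also have "\<dots> = Z ^ (2 * k + 3002) * y" by (simp add: power_add)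
    also have "\<dots> \<le> Z ^ 3100 * Y" using that Z2 by (intro mult_mono power_increasing) auto
    also have "\<dots> \<le> (4 / ln 2 * ln (real (card A * card B))) ^ 3100 * Y"
      using that L(3) Z2 by (intro mult_right_mono power_mono) (auto simp: Z_def)
    finally show ?thesis by (simp add: power_mult_distrib)
  qed
  show ?first
    by (rule lift[OF main(1)], (intro mult_mono power_mono S; simp)) simp_all
  show ?second
    by (rule lift[OF main(2)], (intro mult_mono power_mono S D; simp)) simp_all
qed

text \<open>Two singletons are excluded because \<open>ln 1 = 0\<close> would make the right-hand
  side vanish while the left-hand side is 1.\<close>

theorem theorem18:
  shows "\<exists>C C' :: real. C > 0 \<and> C' > 0 \<and>
    (\<forall>(f :: real \<Rightarrow> real) (g :: real \<Rightarrow> real) (S :: real set) (T :: real set)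
       (A :: real set) (B :: real set).
      (strictly_convex_on S f \<or> strictly_concave_on S f) \<longrightarrow>
      (strictly_convex_on T g \<or> strictly_concave_on T g) \<longrightarrow>
      finite A \<longrightarrow> A \<subseteq> S \<longrightarrow> finite B \<longrightarrow> B \<subseteq> T \<longrightarrow> card A * card B \<noteq> 1 \<longrightarrow>
      real (card A) ^ 49 * real (card B) ^ 49
        \<le> C * (real (card (sumset A B)) ^ 38 * real (card (sumset (f ` A) (g ` B))) ^ 38)
            * ln (real (card A * card B)) powr C' \<and>
      (\<forall>pm1 \<in> {sumset, diffset}. \<forall>pm2 \<in> {sumset, diffset}.
        real (card A) ^ 39 * real (card B) ^ 39
          \<le> C * (real (card (pm1 A B)) ^ 20 * real (card (pm2 (f ` A) (g ` B))) ^ 20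
                 * real (card (diffset A A)) ^ 5 * real (card (diffset B B)) ^ 5
                 * real (card (diffset (f ` A) (f ` A))) ^ 5
                 * real (card (diffset (g ` B) (g ` B))) ^ 5)
              * ln (real (card A * card B)) powr C'))"
proof -
  define k :: nat where "k = 3100"
  define c :: real where "c = 4 / ln 2"
  have c: "c > 0" by (simp add: c_def)
  show ?thesis
  proof (rule exI[of _ "c ^ k"], rule exI[of _ "real k"], intro conjI allI impI ballI)
    show "c ^ k > 0" using c by simp
    show "real k > 0" by (simp add: k_def)
  next
    fix f g :: "real \<Rightarrow> real" and S T A B :: "real set"
    assume h: "strictly_convex_on S f \<or> strictly_concave_on S f" "strictly_convex_on T g \<or> strictly_concave_on T g"
      "finite A" "A \<subseteq> S" "finite B" "B \<subseteq> T" and n1: "card A * card B \<noteq> 1"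
    define l where "l = ln (real (card A * card B))"
    \<comment> \<open>Rewriting \<open>powr\<close> as a natural power requires a positive base.
      Hence the case of an empty set, where the left-hand side is 0, is split off below.\<close>
    have eq: "c ^ k * Y * l powr real k = (c * l) ^ k * Y" if "card A * card B \<noteq> 0" for Y
    proof -
      have "real (card A * card B) \<ge> 2" using that n1 by linarith
      then have "l > 0" unfolding l_def by (intro ln_gt_zero) linarith
      then show ?thesis by (simp add: powr_realpow power_mult_distrib)
    qed
    have zero: "real (card A) ^ 49 * real (card B) ^ 49 = 0" "real (card A) ^ 39 * real (card B) ^ 39 = 0"
      if "card A * card B = 0" using that by auto
    show "real (card A) ^ 49 * real (card B) ^ 49
        \<le> c ^ k * (real (card (sumset A B)) ^ 38 * real (card (sumset (f ` A) (g ` B))) ^ 38)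
            * ln (real (card A * card B)) powr real k"
    proof (cases "card A * card B = 0")
      case True
      show ?thesis unfolding zero(1)[OF True] using c by (intro mult_nonneg_nonneg) auto
    next
      case False
      then have "2 \<le> card A * card B" using n1 by linarith
      then show ?thesis
        unfolding l_def[symmetric] eq[OF False]
        unfolding l_def c_def k_def by (rule convex_sumset_bounds(1)[OF h]) auto
    qed
    fix pm1 pm2 assume pm: "pm1 \<in> {sumset, diffset}" "pm2 \<in> {sumset, diffset}"
    show "real (card A) ^ 39 * real (card B) ^ 39
          \<le> c ^ k * (real (card (pm1 A B)) ^ 20 * real (card (pm2 (f ` A) (g ` B))) ^ 20
                 * real (card (diffset A A)) ^ 5 * real (card (diffset B B)) ^ 5
                 * real (card (diffset (f ` A) (f ` A))) ^ 5
                 * real (card (diffset (g ` B) (g ` B))) ^ 5)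
              * ln (real (card A * card B)) powr real k"
    proof (cases "card A * card B = 0")
      case True
      show ?thesis unfolding zero(2)[OF True] using c by (intro mult_nonneg_nonneg) auto
    next
      case False
      then have "2 \<le> card A * card B" using n1 by linarith
      then show ?thesis
        unfolding l_def[symmetric] eq[OF False]
        unfolding l_def c_def k_def by (rule convex_sumset_bounds(2)[OF h _ pm])
    qed
  qed
qed

end
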